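(* The $3$-MDA problem (Minimum Diameter-$3$ Augmentation) is solvable in polynomial time. That is, there is a polynomial-time algorithm which, given a connected graph $G$ and a positive integer $k$, decides whether there is a set $F\subseteq E(G)$ such that $|F|\le k$ and $G-F$ is a connected graph of diameter at least $3$.
   Context: All graphs are finite, simple and undirected. For $F\subseteq E(G)$, $G-F$ is the graph with vertex set $V(G)$ and edge set $E(G)\setminus F$. The diameter of a connected graph $G$ is $\mathrm{diam}(G)=\max_{u,v\in V(G)}\mathrm{dist}_G(u,v)$, where $\mathrm{dist}_G(u,v)$ is the minimum number of edges of a $u,v$-path. For a fixed positive integer $d$, the Minimum Diameter-$d$ Augmentation problem ($d$-MDA) is the following decision problem. Input: a connected graph $G$ and a positive integer $k$. Question: is there a set $F\subseteq E(G)$ such that $|F|\le k$ and $G-F$ is a connected graph of diameter at least $d$? *)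

theory Defs
  imports
    "HOL-Computational_Algebra.Polynomial"
    "HOL-Library.Log_Nat"
begin

section \<open>Graphs\<close>

text \<open>A finite simple undirected graph is given by its vertex set \<open>V\<close> and its edge set \<open>E\<close>,
  an edge being a two-element set of vertices; \<open>G - F\<close> is then \<open>(V, E - F)\<close>.\<close>

definition simple_graph :: "'a set \<Rightarrow> 'a set set \<Rightarrow> bool" where
  "simple_graph V E \<longleftrightarrow> finite V \<and> (\<forall>e\<in>E. e \<subseteq> V \<and> card e = 2)"

definition graph_path :: "'a set \<Rightarrow> 'a set set \<Rightarrow> 'a \<Rightarrow> 'a list \<Rightarrow> 'a \<Rightarrow> bool" where
  "graph_path V E u p v \<longleftrightarrow>
     p \<noteq> [] \<and> hd p = u \<and> last p = v \<and> set p \<subseteq> V \<and> distinct p \<and>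
     successively (\<lambda>x y. {x, y} \<in> E) p"

definition connected_graph :: "'a set \<Rightarrow> 'a set set \<Rightarrow> bool" where
  "connected_graph V E \<longleftrightarrow> V \<noteq> {} \<and> (\<forall>u\<in>V. \<forall>v\<in>V. \<exists>p. graph_path V E u p v)"

text \<open>The number of edges of a path is one less than its number of vertices.
  The distance and the diameter are only meaningful for connected graphs.\<close>

definition graph_dist :: "'a set \<Rightarrow> 'a set set \<Rightarrow> 'a \<Rightarrow> 'a \<Rightarrow> nat" where
  "graph_dist V E u v = (LEAST l. \<exists>p. graph_path V E u p v \<and> length p = Suc l)"

definition graph_diam :: "'a set \<Rightarrow> 'a set set \<Rightarrow> nat" where
  "graph_diam V E = Max {graph_dist V E u v |u v. u \<in> V \<and> v \<in> V}"


section \<open>Polynomial time\<close>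

text \<open>The machine model is the random access machine of Cook and Reckhow with logarithmic cost,
  with natural numbers in the registers (so subtraction is truncated). It is polynomially
  equivalent to the deterministic Turing machine. All registers are initially 0; the input is a
  bit string that is read sequentially, the end of the input being reported as the value 2.
  The machine halts when the program counter leaves the program, and accepts iff register 0 is
  then nonzero.\<close>

datatype instr =
    Const nat nat    \<comment> \<open>\<open>X\<^sub>i := c\<close>\<close>
  | Add nat nat nat  \<comment> \<open>\<open>X\<^sub>i := X\<^sub>j + X\<^sub>k\<close>\<close>
  | Sub nat nat nat  \<comment> \<open>\<open>X\<^sub>i := X\<^sub>j - X\<^sub>k\<close>\<close>
  | Load nat nat     \<comment> \<open>\<open>X\<^sub>i := X\<^bsub>X\<^sub>j\<^esub>\<close>\<close>
  | Store nat nat    \<comment> \<open>\<open>X\<^bsub>X\<^sub>i\<^esub> := X\<^sub>j\<close>\<close>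
  | Read nat         \<comment> \<open>\<open>X\<^sub>i :=\<close> next input symbol\<close>
  | Jpos nat nat     \<comment> \<open>if \<open>X\<^sub>i > 0\<close> then go to instruction \<open>l\<close>\<close>

type_synonym config = "nat \<times> (nat \<Rightarrow> nat) \<times> bool list"

fun exec :: "instr \<Rightarrow> config \<Rightarrow> config" where
  "exec (Const i c) (pc, X, w) = (Suc pc, X(i := c), w)"
| "exec (Add i j k) (pc, X, w) = (Suc pc, X(i := X j + X k), w)"
| "exec (Sub i j k) (pc, X, w) = (Suc pc, X(i := X j - X k), w)"
| "exec (Load i j) (pc, X, w) = (Suc pc, X(i := X (X j)), w)"
| "exec (Store i j) (pc, X, w) = (Suc pc, X(X i := X j), w)"
| "exec (Read i) (pc, X, []) = (Suc pc, X(i := 2), [])"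
| "exec (Read i) (pc, X, b # w) = (Suc pc, X(i := of_bool b), w)"
| "exec (Jpos i l) (pc, X, w) = (if X i > 0 then l else Suc pc, X, w)"

text \<open>\<open>floorlog 2 n\<close> is the number of binary digits of \<open>n\<close>.\<close>

fun instr_cost :: "instr \<Rightarrow> (nat \<Rightarrow> nat) \<Rightarrow> nat" where
  "instr_cost (Const i c) X = 1"
| "instr_cost (Add i j k) X = 1 + floorlog 2 (X j) + floorlog 2 (X k)"
| "instr_cost (Sub i j k) X = 1 + floorlog 2 (X j) + floorlog 2 (X k)"
| "instr_cost (Load i j) X = 1 + floorlog 2 (X j) + floorlog 2 (X (X j))"
| "instr_cost (Store i j) X = 1 + floorlog 2 (X i) + floorlog 2 (X j)"
| "instr_cost (Read i) X = 1"
| "instr_cost (Jpos i l) X = 1 + floorlog 2 (X i)"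

text \<open>\<open>runs P s t s'\<close>: started in \<open>s\<close>, the program \<open>P\<close> halts in \<open>s'\<close> with total cost \<open>t\<close>.\<close>

inductive runs :: "instr list \<Rightarrow> config \<Rightarrow> nat \<Rightarrow> config \<Rightarrow> bool" for P where
  halt: "pc \<ge> length P \<Longrightarrow> runs P (pc, X, w) 0 (pc, X, w)"
| step: "pc < length P \<Longrightarrow> runs P (exec (P ! pc) (pc, X, w)) t s \<Longrightarrow>
           runs P (pc, X, w) (instr_cost (P ! pc) X + t) s"

text \<open>A decision problem consists of a set \<open>I\<close> of instances, an encoding \<open>enc\<close> of the instances
  as bit strings, and the question \<open>Q\<close>.\<close>

definition poly_time_solvable :: "'i set \<Rightarrow> ('i \<Rightarrow> bool list) \<Rightarrow> ('i \<Rightarrow> bool) \<Rightarrow> bool" where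
  "poly_time_solvable I enc Q \<longleftrightarrow>
     (\<exists>(P :: instr list) (q :: nat poly). \<forall>x\<in>I. \<exists>t pc X w.
        runs P (0, \<lambda>_. 0, enc x) t (pc, X, w) \<and>
        t \<le> poly q (length (enc x)) \<and>
        (X 0 \<noteq> 0 \<longleftrightarrow> Q x))"


section \<open>Minimum Diameter-\<open>d\<close> Augmentation\<close>

text \<open>An instance is a triple \<open>(n, E, k)\<close> describing the graph with vertex set \<open>{..<n}\<close> and edge
  set \<open>E\<close>, and the budget \<open>k\<close>. It is encoded by \<open>n\<close> in unary, followed by the adjacency matrix
  row by row and by \<open>k\<close> in binary, least significant digit first.\<close>

type_synonym mda_instance = "nat \<times> nat set set \<times> nat"

definition mda_instances :: "mda_instance set" where
  "mda_instances = {(n, E, k). simple_graph {..<n} E \<and> connected_graph {..<n} E \<and> k > 0}"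

fun mda_encode :: "mda_instance \<Rightarrow> bool list" where
  "mda_encode (n, E, k) =
     replicate n True @ [False] @
     concat (map (\<lambda>u. map (\<lambda>v. {u, v} \<in> E) [0..<n]) [0..<n]) @
     map (bit k) [0..<floorlog 2 k]"

fun mda_question :: "nat \<Rightarrow> mda_instance \<Rightarrow> bool" where
  "mda_question d (n, E, k) \<longleftrightarrow>
     (\<exists>F\<subseteq>E. card F \<le> k \<and> connected_graph {..<n} (E - F) \<and> graph_diam {..<n} (E - F) \<ge> d)"

end

(* Deleting edges so that two vertices u, v end up at distance at least 3 costs at least
   c(u, v) = [uv is an edge] + number of common neighbours of u and v. The bound is attained, keeping
   the graph connected, as soon as there is a u,v-path u, x, ..., y, v with at least three edges:
   delete uv, the edge vx, and uw for every other common neighbour w. Conversely, such a path exists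
   in every solution. So one has to decide whether there are u, v, x, y with c(u, v) <= k such that x
   is a neighbour of u, y is a neighbour of v, x and y are distinct and differ from u and v, and y is
   reachable from x in G - {u, v}. The random access machine tries all u, v, x and computes
   reachability by n rounds of relaxing all pairs of vertices. *)

theory Submission
  imports Defs
begin

section \<open>Programming the random access machine\<close>

text \<open>The lower bound holds because every common neighbour \<open>w\<close> must lose
  \<open>uw\<close> or \<open>vw\<close>, and these edges are distinct for distinct \<open>w\<close>
  and differ from \<open>uv\<close>. In the construction \<open>x\<close> loses \<open>vx\<close>
  and not \<open>ux\<close> because the path starts with \<open>ux\<close>; its last edge
  \<open>yv\<close> survives as \<open>y\<close> differs from \<open>x\<close>. The graph stays
  connected since the ends of every deleted edge remain joined: \<open>u\<close> and
  \<open>v\<close> by the path, \<open>v\<close> and \<open>x\<close> via \<open>u\<close>, and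
  \<open>u\<close> and any other \<open>w\<close> via \<open>v\<close>. Most of the work lies in the
  machine, whose cost depends on the register contents. As these at most double in a step, a bound
  on the number of steps yields a quadratic bound on the cost, so the Hoare triples count steps
  only. To make the count independent of the data, the number of rounds of each loop is fixed by
  \<open>n\<close> or by the length of the budget. The six nested loops over \<open>u\<close>,
  \<open>v\<close>, \<open>x\<close>, the rounds and the pairs dominate, with about n^6
  steps.\<close>

definition step1 :: "instr list \<Rightarrow> config \<Rightarrow> config \<Rightarrow> bool" where
  "step1 p s s' \<longleftrightarrow> fst s < length p \<and> s' = exec (p ! fst s) s"

lemma exec_bounded:
  assumes "\<forall>r. X r \<le> 2 ^ e" "e \<ge> 1" "\<And>r c. i = Const r c \<Longrightarrow> c \<le> 2 ^ e"
    and "exec i (pc, X, w) = (pc', X', w')"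
  shows "X' r \<le> 2 ^ Suc e"
proof -
  have *: "X r \<le> 2 * 2 ^ e" for r
    using assms(1)[rule_format, of r] by simp
  \<comment> \<open>The value 2 is what \<open>Read\<close> delivers at the end of the
    input.\<close>
  have two: "(2::nat) \<le> 2 * 2 ^ e" by simp
  show ?thesis
  proof (cases i)
    case (Const i c)
    then show ?thesis using assms(3)[OF Const] assms(4) * by (auto intro: le_trans[of c "2 ^ e"])
  next
    case (Add i j k)
    then show ?thesis
      using assms(4) * add_mono[OF assms(1)[rule_format, of j] assms(1)[rule_format, of k]] by auto
  next
    case (Sub i j k)
    then show ?thesis using assms(4) * le_trans[OF diff_le_self *] by auto
  next
    case (Read i)
    then show ?thesis using assms(4) * two by (cases w) auto
  qed (use assms(4) * in auto)
qed

text \<open>An instruction is charged for at most two numbers, each with at most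
  \<open>e + 1\<close> digits: 1 + 2 (e + 1).\<close>

lemma instr_cost_bounded:
  assumes "\<forall>r. X r \<le> 2 ^ e"
  shows "instr_cost i X \<le> 3 + 2 * e"
proof -
  have *: "floorlog 2 (X r) \<le> Suc e" for r
    using floorlog_mono[OF assms[rule_format, of r], of 2] floorlog_power[of 2 e 1]
    by (simp add: floorlog_def split: if_splits)
  show ?thesis
  proof (cases i)
    case (Add i j k) then show ?thesis using *[of j] *[of k] by simp
  next
    case (Sub i j k) then show ?thesis using *[of j] *[of k] by simp
  next
    case (Load i j) then show ?thesis using *[of j] *[of "X j"] by simp
  next
    case (Store i j) then show ?thesis using *[of i] *[of j] by simp
  next
    case (Jpos i l) then show ?thesis using *[of i] by simp
  qed auto
qed

text \<open>A step at most doubles the largest register content, so a bound on the number of steps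
  also bounds the logarithmic cost.\<close>

lemma runs_of_steps:
  assumes "(step1 p ^^ m) (pc, X, w) (pc', X', w')" "pc' \<ge> length p"
    and "\<forall>r. X r \<le> 2 ^ e" "e \<ge> 1" "\<And>r c. Const r c \<in> set p \<Longrightarrow> c \<le> 2 ^ e"
  shows "\<exists>t \<le> m * (3 + 2 * (e + m)). runs p (pc, X, w) t (pc', X', w')"
  using assms
proof (induction m arbitrary: pc X w e)
  case 0
  then show ?case by (auto intro: runs.halt)
next
  case (Suc m)
  obtain pc1 X1 w1 where s: "step1 p (pc, X, w) (pc1, X1, w1)"
    "(step1 p ^^ m) (pc1, X1, w1) (pc', X', w')"
    using Suc.prems(1) by (metis prod_cases3 relpowp_Suc_D2)
  have pc: "pc < length p" and ex: "exec (p ! pc) (pc, X, w) = (pc1, X1, w1)"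
    using s(1) by (auto simp: step1_def)
  have c: "\<And>r c. p ! pc = Const r c \<Longrightarrow> c \<le> 2 ^ e"
    using Suc.prems(5) nth_mem[OF pc] by metis
  have "\<forall>r. X1 r \<le> 2 ^ Suc e"
    using exec_bounded[OF Suc.prems(3,4) _ ex] c by blast
  moreover have "\<And>r c. Const r c \<in> set p \<Longrightarrow> c \<le> 2 ^ Suc e"
    using Suc.prems(5) by (fastforce intro: le_trans)
  \<comment> \<open>One step raises the exponent by one and leaves one step fewer, so the sum of the
    two, on which the cost per step depends, is unchanged.\<close>
  ultimately obtain t where t: "t \<le> m * (3 + 2 * (Suc e + m))"
      "runs p (pc1, X1, w1) t (pc', X', w')"
    using Suc.IH[OF s(2) Suc.prems(2), of "Suc e"] by auto
  have "runs p (pc, X, w) (instr_cost (p ! pc) X + t) (pc', X', w')"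
    using runs.step[OF pc] t(2) ex by simp
  moreover have "instr_cost (p ! pc) X + t \<le> Suc m * (3 + 2 * (e + Suc m))"
    using instr_cost_bounded[OF Suc.prems(3), of "p ! pc"] t(1) by (simp add: algebra_simps)
  ultimately show ?case by blast
qed

text \<open>Jump targets are absolute, so a piece of code depends on the address where it is placed.\<close>

type_synonym code = "nat \<Rightarrow> instr list"

type_synonym assn = "(nat \<Rightarrow> nat) \<Rightarrow> bool list \<Rightarrow> bool"

section \<open>Relocatable code and step-counting Hoare triples\<close>

definition block :: "instr list \<Rightarrow> code" where
  "block is = (\<lambda>_. is)"

definition sequ :: "code \<Rightarrow> code \<Rightarrow> code" (infixr \<open>;;\<close> 60) where
  "c ;; d = (\<lambda>b. c b @ d (b + length (c b)))"

text \<open>A do-while loop: the body runs before the first test, so there is always at least one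
  round.\<close>

definition repeat_while :: "code \<Rightarrow> nat \<Rightarrow> code" where
  "repeat_while c r = (\<lambda>b. c b @ [Jpos r b])"

text \<open>Quantifying over \<open>pre\<close> and \<open>post\<close> makes triples independent of
  the address, so they compose without relocation arguments. Termination is included, with
  \<open>t\<close> bounding the number of steps.\<close>

definition hoare :: "assn \<Rightarrow> code \<Rightarrow> nat \<Rightarrow> assn \<Rightarrow> bool" where
  "hoare P c t Q \<longleftrightarrow>
     (\<forall>pre post X w. P X w \<longrightarrow>
       (\<exists>m\<le>t. \<exists>X' w'. Q X' w' \<and>
          (step1 (pre @ c (length pre) @ post) ^^ m) (length pre, X, w)
            (length pre + length (c (length pre)), X', w')))"

lemma hoareD:
  assumes "hoare P c t Q" "P X w" "p = pre @ c b @ post" "b = length pre"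
  shows "\<exists>m X' w'. m \<le> t \<and> Q X' w' \<and> (step1 p ^^ m) (b, X, w) (b + length (c b), X', w')"
  using assms unfolding hoare_def by blast

lemma hoareI:
  assumes "\<And>p pre post b X w. P X w \<Longrightarrow> p = pre @ c b @ post \<Longrightarrow> b = length pre \<Longrightarrow>
    \<exists>m X' w'. m \<le> t \<and> Q X' w' \<and> (step1 p ^^ m) (b, X, w) (b + length (c b), X', w')"
  shows "hoare P c t Q"
  using assms unfolding hoare_def by blast

lemma hoare_conseq:
  assumes "hoare P c t Q" "\<And>X w. P' X w \<Longrightarrow> P X w" "\<And>X w. Q X w \<Longrightarrow> Q' X w" "t \<le> t'"
  shows "hoare P' c t' Q'"
proof (rule hoareI)
  fix p pre post :: "instr list" and b X w
  assume "P' X w" "p = pre @ c b @ post" "b = length pre"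
  from hoareD[OF assms(1) assms(2)[OF this(1)] this(2,3)]
  obtain m X' w' where "m \<le> t" "Q X' w'"
    "(step1 p ^^ m) (b, X, w) (b + length (c b), X', w')" by blast
  then show "\<exists>m X' w'. m \<le> t' \<and> Q' X' w' \<and>
      (step1 p ^^ m) (b, X, w) (b + length (c b), X', w')"
    using assms(3,4) by (blast intro: le_trans)
qed

lemma hoare_sequ:
  assumes "hoare P c t Q" "hoare Q d t' R"
  shows "hoare P (c ;; d) (t + t') R"
proof (rule hoareI)
  fix p pre post :: "instr list" and b X w
  assume P: "P X w" and p: "p = pre @ (c ;; d) b @ post" and b: "b = length pre"
  let ?b = "b + length (c b)"
  have p1: "p = pre @ c b @ (d ?b @ post)" using p by (simp add: sequ_def)
  have p2: "p = (pre @ c b) @ d ?b @ post" using p by (simp add: sequ_def)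
  obtain m X1 w1 where 1: "m \<le> t" "Q X1 w1" "(step1 p ^^ m) (b, X, w) (?b, X1, w1)"
    using hoareD[OF assms(1) P p1 b] by blast
  obtain m' X2 w2 where 2: "m' \<le> t'" "R X2 w2"
    "(step1 p ^^ m') (?b, X1, w1) (?b + length (d ?b), X2, w2)"
    using hoareD[OF assms(2) 1(2) p2] b by auto
  have "(step1 p ^^ (m + m')) (b, X, w) (?b + length (d ?b), X2, w2)"
    unfolding relpowp_add using 1(3) 2(3) by blast
  moreover have "?b + length (d ?b) = b + length ((c ;; d) b)"
    by (simp add: sequ_def)
  ultimately show "\<exists>m X' w'. m \<le> t + t' \<and> R X' w' \<and>
      (step1 p ^^ m) (b, X, w) (b + length ((c ;; d) b), X', w')"
    using add_mono[OF 1(1) 2(1)] 2(2) by metis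
qed

fun straight :: "instr \<Rightarrow> bool" where
  "straight (Jpos _ _) = False"
| "straight _ = True"

definition eff :: "instr \<Rightarrow> (nat \<Rightarrow> nat) \<times> bool list \<Rightarrow> (nat \<Rightarrow> nat) \<times> bool list" where
  "eff i s = snd (exec i (0, s))"

lemma eff_simps [simp]:
  "eff (Const i c) (X, w) = (X(i := c), w)"
  "eff (Add i j k) (X, w) = (X(i := X j + X k), w)"
  "eff (Sub i j k) (X, w) = (X(i := X j - X k), w)"
  "eff (Load i j) (X, w) = (X(i := X (X j)), w)"
  "eff (Store i j) (X, w) = (X(X i := X j), w)"
  "eff (Read i) (X, []) = (X(i := 2), [])"
  "eff (Read i) (X, b # w) = (X(i := of_bool b), w)"
  by (simp_all add: eff_def)

lemma exec_straight: "straight i \<Longrightarrow> exec i (pc, s) = (Suc pc, eff i s)"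
  by (cases s; cases "snd s"; cases i) auto

text \<open>Turns a triple about straight-line code into symbolic execution by the
  simplifier.\<close>

lemma hoare_block:
  assumes "list_all straight is"
    and "\<And>X w. P X w \<Longrightarrow> case fold eff is (X, w) of (X', w') \<Rightarrow> Q X' w'"
  shows "hoare P (block is) (length is) Q"
proof -
  have *: "(step1 (pre @ is @ post) ^^ length is) (length pre, s) (length pre + length is, fold eff is s)"
    if "list_all straight is" for pre post s "is"
    using that
  proof (induction "is" arbitrary: pre s)
    case (Cons i "is")
    have "step1 (pre @ (i # is) @ post) (length pre, s) (Suc (length pre), eff i s)"
      using Cons.prems by (simp add: step1_def exec_straight)
    moreover have "(step1 (pre @ (i # is) @ post) ^^ length is) (Suc (length pre), eff i s)
        (length pre + length (i # is), fold eff (i # is) s)"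
      using Cons.IH[of "pre @ [i]" "eff i s"] Cons.prems by simp
    ultimately show ?case by (metis length_Cons relpowp_Suc_I2)
  qed simp
  show ?thesis
  proof (rule hoareI)
    fix p pre post :: "instr list" and b X w
    assume P: "P X w" and p: "p = pre @ block is b @ post" and b: "b = length pre"
    obtain X' w' where f: "fold eff is (X, w) = (X', w')" by fastforce
    have "(step1 p ^^ length is) (b, X, w) (b + length is, X', w')"
      using *[OF assms(1), of pre post "(X, w)"] f p b by (simp add: block_def)
    moreover have "Q X' w'" using assms(2)[OF P] f by simp
    ultimately show "\<exists>m X' w'. m \<le> length is \<and> Q X' w' \<and>
        (step1 p ^^ m) (b, X, w) (b + length (block is b), X', w')"
      unfolding block_def by blast
  qed
qed

text \<open>The number of rounds is known beforehand: register \<open>r\<close> has to be positive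
  exactly while rounds are left. The jump adds one step to each round.\<close>

lemma hoare_repeat_while:
  assumes body: "\<And>j. j < m \<Longrightarrow>
      hoare (I j) c t (\<lambda>X w. I (Suc j) X w \<and> (X r > 0 \<longleftrightarrow> Suc j < m))"
    and m: "m > 0"
  shows "hoare (I 0) (repeat_while c r) (m * Suc t) (I m)"
proof (rule hoareI)
  fix p pre post :: "instr list" and b X w
  assume I: "I 0 X w" and p: "p = pre @ repeat_while c r b @ post" and b: "b = length pre"
  let ?e = "b + length (c b)"
  have p': "p = pre @ c b @ (Jpos r b # post)" using p by (simp add: repeat_while_def)
  have jump: "p ! ?e = Jpos r b" "?e < length p" by (simp_all add: p' b nth_append)
  have round: "\<exists>l X2 w2. l \<le> Suc t \<and> I (Suc j) X2 w2 \<and>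
      (step1 p ^^ l) (b, X1, w1) (if Suc j < m then b else Suc ?e, X2, w2)"
    if j: "j < m" and I1: "I j X1 w1" for j X1 w1
  proof -
    obtain l X2 w2 where l: "l \<le> t" "I (Suc j) X2 w2" "0 < X2 r \<longleftrightarrow> Suc j < m"
      "(step1 p ^^ l) (b, X1, w1) (?e, X2, w2)"
      using hoareD[OF body[OF j] I1 p' b] by (elim exE conjE)
    have "step1 p (?e, X2, w2) (if Suc j < m then b else Suc ?e, X2, w2)"
      using l(3) jump by (simp add: step1_def)
    with l(4) have "(step1 p ^^ Suc l) (b, X1, w1) (if Suc j < m then b else Suc ?e, X2, w2)"
      by (rule relpowp_Suc_I)
    then show ?thesis using l(1,2) by (meson Suc_le_mono)
  qed
  \<comment> \<open>The index \<open>j\<close> stands for \<open>Suc j\<close> completed rounds, as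
    the first round is unconditional.\<close>
  have iter: "\<exists>l X' w'. l \<le> Suc j * Suc t \<and> I (Suc j) X' w' \<and>
      (step1 p ^^ l) (b, X, w) (if Suc j < m then b else Suc ?e, X', w')" if "j < m" for j
    using that
  proof (induction j)
    case 0
    then show ?case using round[OF 0 I] by simp
  next
    case (Suc j)
    then obtain l0 X0 w0 where 0: "l0 \<le> Suc j * Suc t" "I (Suc j) X0 w0"
      "(step1 p ^^ l0) (b, X, w) (b, X0, w0)" by auto
    obtain l X' w' where l: "l \<le> Suc t" "I (Suc (Suc j)) X' w'"
      "(step1 p ^^ l) (b, X0, w0) (if Suc (Suc j) < m then b else Suc ?e, X', w')"
      using round[OF Suc.prems 0(2)] by blast
    have "(step1 p ^^ (l0 + l)) (b, X, w) (if Suc (Suc j) < m then b else Suc ?e, X', w')"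
      unfolding relpowp_add using 0(3) l(3) by blast
    moreover have "l0 + l \<le> Suc (Suc j) * Suc t" using 0(1) l(1) by simp
    ultimately show ?case using l(2) by blast
  qed
  have "b + length (repeat_while c r b) = Suc ?e" by (simp add: repeat_while_def)
  then show "\<exists>l X' w'. l \<le> m * Suc t \<and> I m X' w' \<and>
      (step1 p ^^ l) (b, X, w) (b + length (repeat_while c r b), X', w')"
    using iter[of "m - 1"] m by simp
qed


section \<open>Augmentation to diameter 3\<close>

lemma simple_graph_edgeD:
  assumes "simple_graph V E" "{a, b} \<in> E"
  shows "a \<noteq> b" "a \<in> V" "b \<in> V"
proof -
  have "{a, b} \<subseteq> V" "card {a, b} = 2" using assms unfolding simple_graph_def by blast+
  then show "a \<noteq> b" "a \<in> V" "b \<in> V" by auto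
qed

text \<open>Connectivity is argued with walks, which concatenate freely. A path is recovered by
  cutting off the loop whenever the walk returns to a vertex of the path.\<close>

lemma graph_path_of_walk:
  assumes "simple_graph V E" "(\<lambda>a b. {a, b} \<in> E)\<^sup>*\<^sup>* u v" "u \<in> V"
  shows "\<exists>p. graph_path V E u p v"
  using assms(2)
proof (induction rule: rtranclp_induct)
  case base
  then show ?case using assms(3) by (auto simp: graph_path_def intro: exI[of _ "[u]"])
next
  case (step x z)
  then obtain p where p: "graph_path V E u p x" by blast
  show ?case
  proof (cases "z \<in> set p")
    case True
    then obtain q r where qr: "p = q @ z # r" by (meson split_list)
    have "graph_path V E u (q @ [z]) z"
      using p unfolding graph_path_def qr
      by (auto simp: successively_append_iff hd_append split: if_splits)
    then show ?thesis by blast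
  next
    case False
    then have "graph_path V E u (p @ [z]) z"
      using p step.hyps(2) simple_graph_edgeD[OF assms(1) step.hyps(2)] unfolding graph_path_def
      by (auto simp: successively_append_iff)
    then show ?thesis by blast
  qed
qed

lemma walk_of_graph_path:
  assumes "graph_path V E u p v"
  shows "(\<lambda>a b. {a, b} \<in> E)\<^sup>*\<^sup>* u v"
proof -
  have "p \<noteq> [] \<Longrightarrow> successively R p \<Longrightarrow> R\<^sup>*\<^sup>* (hd p) (last p)" for R and p :: "'a list"
    by (induction p rule: induct_list012) (auto intro: converse_rtranclp_into_rtranclp)
  then show ?thesis using assms unfolding graph_path_def by metis
qed

lemma graph_dist_le: "graph_path V E u p v \<Longrightarrow> graph_dist V E u v \<le> length p - 1"
  unfolding graph_dist_def by (rule Least_le) (auto simp: graph_path_def intro!: exI[of _ p])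

lemma graph_dist_path:
  assumes "graph_path V E u p v"
  obtains q where "graph_path V E u q v" "length q = Suc (graph_dist V E u v)"
proof -
  have "\<exists>l p. graph_path V E u p v \<and> length p = Suc l"
    using assms by (intro exI[of _ "length p - 1"] exI[of _ p]) (auto simp: graph_path_def)
  from LeastI_ex[OF this] show ?thesis using that unfolding graph_dist_def by blast
qed

lemma graph_diam_ge_iff:
  assumes "finite V" "V \<noteq> {}"
  shows "d \<le> graph_diam V E \<longleftrightarrow> (\<exists>u\<in>V. \<exists>v\<in>V. d \<le> graph_dist V E u v)"
proof -
  have "{graph_dist V E u v |u v. u \<in> V \<and> v \<in> V} = (\<lambda>(u, v). graph_dist V E u v) ` (V \<times> V)"
    by auto
  then show ?thesis
    unfolding graph_diam_def using assms by (subst Max_ge_iff) auto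
qed

text \<open>A path with at most two edges is a single vertex, an edge, or a detour over a common
  neighbour. The given path \<open>p\<close> guarantees that the \<open>LEAST\<close> in the
  distance is attained.\<close>

lemma graph_dist_ge_3_iff:
  assumes "simple_graph V E" "u \<in> V" "v \<in> V" "graph_path V E u p v"
  shows "3 \<le> graph_dist V E u v \<longleftrightarrow>
    u \<noteq> v \<and> {u, v} \<notin> E \<and> (\<forall>w. \<not> ({u, w} \<in> E \<and> {v, w} \<in> E))"
proof (rule iffI)
  assume 3: "3 \<le> graph_dist V E u v"
  have far: "\<not> graph_path V E u q v" if "length q \<le> 3" for q
    using graph_dist_le[of V E u q v] that 3 by linarith
  have "u \<noteq> v" using far[of "[u]"] assms(2) by (auto simp: graph_path_def)
  moreover from this have "{u, v} \<notin> E"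
    using far[of "[u, v]"] assms(2,3) by (auto simp: graph_path_def)
  moreover have "\<not> ({u, w} \<in> E \<and> {v, w} \<in> E)" for w
    using far[of "[u, w, v]"] assms(2,3) \<open>u \<noteq> v\<close> simple_graph_edgeD[OF assms(1), of u w]
      simple_graph_edgeD[OF assms(1), of v w]
    by (auto simp: graph_path_def insert_commute)
  ultimately show "u \<noteq> v \<and> {u, v} \<notin> E \<and> (\<forall>w. \<not> ({u, w} \<in> E \<and> {v, w} \<in> E))" by blast
next
  assume *: "u \<noteq> v \<and> {u, v} \<notin> E \<and> (\<forall>w. \<not> ({u, w} \<in> E \<and> {v, w} \<in> E))"
  obtain q where q: "graph_path V E u q v" "length q = Suc (graph_dist V E u v)"
    using graph_dist_path[OF assms(4)] .
  show "3 \<le> graph_dist V E u v"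
  proof (rule ccontr)
    assume "\<not> 3 \<le> graph_dist V E u v"
    then consider "length q = 1" | "length q = 2" | "length q = 3" using q(2) by linarith
    then show False
      using q(1) * by cases
        (auto simp: graph_path_def length_Suc_conv numeral_eq_Suc insert_commute)
  qed
qed

section \<open>Separating a pair of vertices\<close>

text \<open>Only the target is tested: hops that start outside \<open>{u, v}\<close> stay
  outside.\<close>

definition hop :: "'a set set \<Rightarrow> 'a \<Rightarrow> 'a \<Rightarrow> 'a \<Rightarrow> 'a \<Rightarrow> bool" where
  "hop E u v a b \<longleftrightarrow> {a, b} \<in> E \<and> b \<noteq> u \<and> b \<noteq> v"

definition cut_size :: "'a set set \<Rightarrow> 'a \<Rightarrow> 'a \<Rightarrow> nat" where
  "cut_size E u v = of_bool ({u, v} \<in> E) + card {w. {u, w} \<in> E \<and> {v, w} \<in> E}"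

text \<open>The hypotheses describe a \<open>u\<close>,\<open>v\<close>-path with at least three edges, from \<open>u\<close> to \<open>x\<close> and
  from \<open>y\<close> to \<open>v\<close>. Deleting \<open>uv\<close>, \<open>vx\<close> and, for every other common neighbour \<open>w\<close>, the edge \<open>uw\<close>
  leaves that path intact.\<close>

lemma augmentation_exists:
  assumes G: "simple_graph V E" "connected_graph V E"
    and uv: "u \<noteq> v" "u \<in> V" "v \<in> V"
    and x: "{u, x} \<in> E" "x \<noteq> v" and xy: "(hop E u v)\<^sup>*\<^sup>* x y" and y: "y \<noteq> x" "{v, y} \<in> E"
  shows "\<exists>F\<subseteq>E. card F \<le> cut_size E u v \<and> connected_graph V (E - F) \<and> 3 \<le> graph_diam V (E - F)"
proof -
  define W where "W = {w. {u, w} \<in> E \<and> {v, w} \<in> E}"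
  define F where "F = E \<inter> {{u, v}} \<union> (\<lambda>w. if w = x then {v, x} else {u, w}) ` W"
  note edge = simple_graph_edgeD[OF G(1)]
  have FE: "F \<subseteq> E" by (auto simp: F_def W_def)
  have G': "simple_graph V (E - F)" using G(1) by (auto simp: simple_graph_def)
  have V: "finite V" "V \<noteq> {}" using G by (auto simp: simple_graph_def connected_graph_def)
  have "finite W" using edge V(1) by (auto simp: W_def intro: finite_subset[of _ V])
  have "card F \<le> card (E \<inter> {{u, v}}) + card W"
    unfolding F_def using card_image_le[OF \<open>finite W\<close>] by (meson add_left_mono card_Un_le le_trans)
  also have "card (E \<inter> {{u, v}}) = of_bool ({u, v} \<in> E)" by auto
  finally have card: "card F \<le> cut_size E u v" by (simp add: cut_size_def W_def)
  let ?r = "\<lambda>a b. {a, b} \<in> E - F"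
  have sym: "?r\<^sup>*\<^sup>* b a" if "?r\<^sup>*\<^sup>* a b" for a b
  proof -
    have "symp ?r" by (rule sympI) (simp only: insert_commute)
    from sympD[OF symp_rtranclp[OF this]] that show ?thesis .
  qed
  have xu: "x \<noteq> u" using edge[OF x(1)] by simp
  \<comment> \<open>\<open>F\<close> contains \<open>{u, w}\<close> only for \<open>w\<close> other
    than \<open>x\<close>, which is why \<open>x\<close> is treated separately.\<close>
  have ux: "?r u x" using x uv xu by (auto simp: F_def doubleton_eq_iff)
  \<comment> \<open>Every deleted edge meets \<open>u\<close> or \<open>v\<close>, so all hops
    inside the rest of the graph survive.\<close>
  have inner: "?r a b" if "{a, b} \<in> E" "a \<noteq> u" "a \<noteq> v" "b \<noteq> u" "b \<noteq> v" for a b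
  proof -
    have "u \<in> e \<or> v \<in> e" if "e \<in> F" for e
      using that by (auto simp: F_def split: if_splits)
    from this[of "{a, b}"] that show ?thesis by blast
  qed
  have xy': "?r\<^sup>*\<^sup>* x y \<and> y \<noteq> u \<and> y \<noteq> v" using xy
  proof (induction rule: rtranclp_induct)
    case (step a b)
    have ab: "{a, b} \<in> E" "b \<noteq> u" "b \<noteq> v" using step.hyps(2) by (auto simp: hop_def)
    then have "?r a b" using inner step.IH by blast
    with step.IH ab show ?case by (blast intro: rtranclp.rtrancl_into_rtrancl)
  qed (use xu x in auto)
  \<comment> \<open>The only edges at \<open>v\<close> that can be deleted are \<open>uv\<close> and
    \<open>vx\<close>.\<close>
  moreover have "?r y v"
  proof -
    have "y \<noteq> u" "y \<noteq> v" "{y, v} \<in> E" using xy' y(2) by (simp_all add: insert_commute)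
    with y(1) uv(1) show ?thesis by (auto simp: F_def doubleton_eq_iff)
  qed
  ultimately have uv': "?r\<^sup>*\<^sup>* u v" using ux
    by (meson converse_rtranclp_into_rtranclp rtranclp.rtrancl_into_rtrancl)
  have wv: "?r v w" if "w \<in> W" "w \<noteq> x" for w
  proof -
    have "u \<in> e \<or> e = {v, x}" if "e \<in> F" for e
      using that by (auto simp: F_def split: if_splits)
    moreover have "{u, w} \<in> E" "{v, w} \<in> E" using that(1) by (simp_all add: W_def)
    ultimately show ?thesis
      using edge(1)[of u w] uv(1) that(2) by (metis DiffI doubleton_eq_iff insertE singletonD)
  qed
  have uw: "?r\<^sup>*\<^sup>* u w" if "w \<in> W" for w
  proof (cases "w = x")
    case False
    then show ?thesis using uv' wv[OF that] by (meson rtranclp.rtrancl_into_rtrancl)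
  qed (use ux in auto)
  have vx: "?r\<^sup>*\<^sup>* v x" using sym[OF uv'] ux by (meson rtranclp.rtrancl_into_rtrancl)
  \<comment> \<open>Connectivity is inherited from \<open>E\<close> edge by edge: a deleted edge is
    replaced by a surviving walk between its ends.\<close>
  have edges: "?r\<^sup>*\<^sup>* a b" if "{a, b} \<in> E" for a b
  proof (cases "{a, b} \<in> F")
    case True
    then have "{a, b} = {u, v} \<or> {a, b} = {v, x} \<or> (\<exists>w\<in>W. {a, b} = {u, w})"
      by (auto simp: F_def split: if_splits)
    then obtain c d where "?r\<^sup>*\<^sup>* c d" "{a, b} = {c, d}" using uv' vx uw by blast
    then show ?thesis using sym[of c d] unfolding doubleton_eq_iff by (elim disjE conjE) simp_all
  qed (use that in auto)
  have walks: "?r\<^sup>*\<^sup>* a b" if "(\<lambda>a b. {a, b} \<in> E)\<^sup>*\<^sup>* a b" for a b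
    using that
  proof (induction rule: rtranclp_induct)
    case (step c d)
    show ?case by (rule rtranclp_trans[OF step.IH edges[OF step.hyps(2)]])
  qed simp
  have conn: "connected_graph V (E - F)"
    unfolding connected_graph_def
  proof (intro conjI ballI)
    fix a b assume "a \<in> V" "b \<in> V"
    then show "\<exists>p. graph_path V (E - F) a p b"
      using G(2) walk_of_graph_path walks graph_path_of_walk[OF G']
      unfolding connected_graph_def by metis
  qed (use V in auto)
  then obtain p where p: "graph_path V (E - F) u p v"
    using uv by (auto simp: connected_graph_def)
  have "\<not> (?r u w \<and> ?r v w)" for w
  proof
    assume w: "?r u w \<and> ?r v w"
    then have "w \<in> W" by (simp add: W_def)
    then have "(if w = x then {v, x} else {u, w}) \<in> F" unfolding F_def by blast
    with w show False by (auto split: if_splits)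
  qed
  then have "3 \<le> graph_dist V (E - F) u v"
    using graph_dist_ge_3_iff[OF G' uv(2,3) p] uv(1) by (auto simp: F_def)
  then have "3 \<le> graph_diam V (E - F)"
    using graph_diam_ge_iff[OF V] uv by blast
  with FE card conn show ?thesis by blast
qed

lemma successively_relpowp: "successively R (x # q) \<Longrightarrow> (R ^^ length q) x (last (x # q))"
  by (induction q arbitrary: x) (auto intro: relpowp_Suc_I2 simp del: relpowp.simps(2))

text \<open>Any path of the remaining graph between two vertices at distance at least 3 is a
  witness: \<open>x\<close> is its second and \<open>y\<close> its last but one vertex. Its vertices
  are distinct, which bounds the number \<open>m\<close> of hops, so that a fixed number of rounds
  finds it.\<close>

lemma augmentation_necessary:
  assumes G: "simple_graph V E" and F: "F \<subseteq> E"
    and conn: "connected_graph V (E - F)" and diam: "3 \<le> graph_diam V (E - F)"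
  obtains u v x y m where "u \<in> V" "v \<in> V" "u \<noteq> v" "{u, x} \<in> E" "x \<noteq> v"
    "(hop E u v ^^ m) x y" "m \<le> card V" "y \<noteq> x" "{v, y} \<in> E" "cut_size E u v \<le> card F"
proof -
  have G': "simple_graph V (E - F)" using G by (auto simp: simple_graph_def)
  have V: "finite V" "V \<noteq> {}" using G conn by (auto simp: simple_graph_def connected_graph_def)
  obtain u v where uv: "u \<in> V" "v \<in> V" and d: "3 \<le> graph_dist V (E - F) u v"
    using graph_diam_ge_iff[OF V] diam by blast
  obtain p where p: "graph_path V (E - F) u p v"
    using conn uv by (auto simp: connected_graph_def)
  have far: "u \<noteq> v" "{u, v} \<notin> E - F" "\<And>w. \<not> ({u, w} \<in> E - F \<and> {v, w} \<in> E - F)"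
    using graph_dist_ge_3_iff[OF G' uv p] d by blast+
  have "4 \<le> length p" using graph_dist_le[OF p] d by linarith
  then obtain x q0 where q0: "p = u # x # q0" "2 \<le> length q0"
    using p by (auto simp: graph_path_def numeral_eq_Suc Suc_le_length_iff)
  have "q0 \<noteq> []" "last q0 = v" "butlast q0 \<noteq> []"
    using q0 p by (auto simp: graph_path_def simp flip: length_0_conv)
  then obtain q where q: "p = u # x # q @ [v]" "q \<noteq> []"
    using q0(1) append_butlast_last_id by metis
  have s: "distinct (u # x # q @ [v])" "successively (\<lambda>a b. {a, b} \<in> E - F) (u # x # q @ [v])"
    "set p \<subseteq> V"
    using p by (simp_all add: graph_path_def q)
  \<comment> \<open>By distinctness \<open>u\<close> and \<open>v\<close> do not occur in
    \<open>q\<close>; membership in \<open>set q\<close> is carried along to use this at every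
    hop.\<close>
  have "successively (hop E u v) (x # q)"
  proof (rule successively_mono)
    show "successively (\<lambda>a b. {a, b} \<in> E - F \<and> b \<in> set q) (x # q)"
    proof -
      have "successively (\<lambda>a b. {a, b} \<in> E - F) (x # q)"
        using s(2) by (auto simp: successively_append_iff successively_Cons)
      then show ?thesis
        by (induction q arbitrary: x) (auto intro: successively_mono)
    qed
  qed (use s(1) in \<open>auto simp: hop_def\<close>)
  from successively_relpowp[OF this]
  have hops: "(hop E u v ^^ length q) x (last q)" using q(2) by simp
  have "card (set q) \<le> card V" using s(3) V(1) by (intro card_mono) (auto simp: q)
  then have len: "length q \<le> card V" using s(1) by (simp add: distinct_card)
  have "{x, u} \<in> E" "{last q, v} \<in> E"
    using s(2) q(2) by (auto simp: successively_append_iff successively_Cons insert_commute)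
  note ends = this
  have "last q \<noteq> x" "x \<noteq> v" using s(1) last_in_set[OF q(2)] by auto
  define W where "W = {w. {u, w} \<in> E \<and> {v, w} \<in> E}"
  \<comment> \<open>If \<open>uw\<close> survives, then \<open>vw\<close> is deleted, since
    \<open>w\<close> would otherwise still be a common neighbour. So \<open>g\<close> maps
    \<open>W\<close> into \<open>F\<close>, injectively and never to \<open>uv\<close>.\<close>
  define g where "g w = (if {u, w} \<in> F then {u, w} else {v, w})" for w
  note edge = simple_graph_edgeD[OF G]
  have W: "w \<noteq> u \<and> w \<noteq> v \<and> w \<in> V" if "w \<in> W" for w
    using that edge[of u w] edge[of v w] by (auto simp: W_def)
  have "inj_on g W"
    using W by (intro inj_onI) (auto simp: g_def doubleton_eq_iff split: if_splits)
  then have "card W = card (g ` W)" by (simp add: card_image)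
  moreover have finF: "finite F"
    using G F by (auto simp: simple_graph_def intro!: finite_subset[of F "Pow V"])
  moreover have "E \<inter> {{u, v}} \<union> g ` W \<subseteq> F"
    using far(2,3) by (auto simp: g_def W_def)
  moreover have "E \<inter> {{u, v}} \<inter> g ` W = {}"
    using W by (auto simp: g_def doubleton_eq_iff split: if_splits)
  moreover have "card (E \<inter> {{u, v}}) = of_bool ({u, v} \<in> E)" by auto
  ultimately have "cut_size E u v \<le> card F"
    unfolding cut_size_def W_def[symmetric]
    by (metis card_Un_disjoint card_mono finite_Un finite_subset)
  then show ?thesis
    using that[of u v x "length q" "last q"] uv far(1) hops len ends \<open>last q \<noteq> x\<close> \<open>x \<noteq> v\<close>
    by (simp add: insert_commute)
qed


section \<open>The program\<close>

text \<open>Registers: 0 result, 2 number of vertices, 3 the constant 1, 5 base address of the marks,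
  6 budget, 7 loop condition. The adjacency matrix is stored from address 40 on and is followed by
  the marks. A loop variable \<open>j\<close> in register \<open>i\<close> is accompanied by the address of row \<open>j\<close> in
  register \<open>i + 1\<close>. Truth values are 0 and 1, so that no conditional jumps are needed.\<close>

definition row :: "nat \<Rightarrow> (nat \<Rightarrow> nat) \<Rightarrow> nat \<Rightarrow> nat \<Rightarrow> bool" where
  "row n X i j \<longleftrightarrow> X i = j \<and> X (Suc i) = 40 + j * n"

text \<open>The row address is advanced by \<open>n\<close> in each round, as the machine cannot
  multiply. The truncated difference in register 7 is positive while rounds are left.\<close>

definition vfor :: "nat \<Rightarrow> code \<Rightarrow> code" where
  "vfor i c = block [Const i 0, Const (Suc i) 40] ;;
     repeat_while (c ;; block [Add i i 3, Add (Suc i) (Suc i) 2, Sub 7 2 i]) 7"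

text \<open>The invariant must not depend on the three registers that control the loop;
  \<open>row\<close> is supplied to the body separately. Each round costs 3 steps for the increments
  and 1 for the jump besides the body.\<close>

lemma hoare_vfor:
  assumes n: "n > 0" and i: "7 < i"
    and regs: "\<And>j X w. I j X w \<Longrightarrow> X 2 = n \<and> X 3 = 1"
    and frame: "\<And>j X w a b c. I j X w \<Longrightarrow> I j (X(i := a, Suc i := b, 7 := c)) w"
    and body: "\<And>j. j < n \<Longrightarrow> hoare (\<lambda>X w. I j X w \<and> row n X i j) c t (\<lambda>X w. I (Suc j) X w \<and> row n X i j)"
  shows "hoare (I 0) (vfor i c) (2 + n * (t + 4)) (I n)"
proof -
  let ?J = "\<lambda>j X w. I j X w \<and> row n X i j"
  have init: "hoare (I 0) (block [Const i 0, Const (Suc i) 40]) 2 (?J 0)"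
  proof (rule hoare_conseq[OF hoare_block[where P = "I 0" and Q = "?J 0"]])
    fix X w assume "I 0 X w"
    \<comment> \<open>The initialisation leaves register 7 alone, so the frame condition is used
      with its current content.\<close>
    from frame[OF this, of 0 40 "X 7"] i
    have "I 0 (X(i := 0, Suc i := 40)) w"
      by (subst (asm) fun_upd_idem) auto
    then show "case fold eff [Const i 0, Const (Suc i) 40] (X, w) of (X', w') \<Rightarrow> ?J 0 X' w'"
      by (simp add: row_def)
  qed auto
  have incr: "hoare (\<lambda>X w. I (Suc j) X w \<and> row n X i j)
      (block [Add i i 3, Add (Suc i) (Suc i) 2, Sub 7 2 i]) 3
      (\<lambda>X w. ?J (Suc j) X w \<and> (X 7 > 0 \<longleftrightarrow> Suc j < n))" for j
  proof (rule hoare_conseq[OF hoare_block])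
    fix X w assume *: "I (Suc j) X w \<and> row n X i j"
    have "I (Suc j) (X(i := a, Suc i := b, 7 := c)) w" for a b c using frame * by blast
    then show "case fold eff [Add i i 3, Add (Suc i) (Suc i) 2, Sub 7 2 i] (X, w) of
        (X', w') \<Rightarrow> ?J (Suc j) X' w' \<and> (X' 7 > 0 \<longleftrightarrow> Suc j < n)"
      using regs[of "Suc j" X w] * i by (auto simp: row_def)
  qed auto
  have "hoare (?J 0) (repeat_while (c ;; block [Add i i 3, Add (Suc i) (Suc i) 2, Sub 7 2 i]) 7)
      (n * Suc (t + 3)) (?J n)"
    by (rule hoare_repeat_while) (use hoare_sequ[OF body incr] n in auto)
  from hoare_sequ[OF init this] show ?thesis
    unfolding vfor_def by (rule hoare_conseq) auto
qed

definition get_i :: "nat \<Rightarrow> nat \<Rightarrow> nat \<Rightarrow> instr list" where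
  "get_i t p q = [Add t p q, Load t t]"

definition and_i :: "nat \<Rightarrow> nat \<Rightarrow> nat \<Rightarrow> instr list" where
  "and_i t p q = [Add t p q, Sub t t 3]"

text \<open>Subtracting twice from 1 clips a number to 0 or 1.\<close>

definition or_i :: "nat \<Rightarrow> nat \<Rightarrow> nat \<Rightarrow> instr list" where
  "or_i t p q = [Add t p q, Sub t 3 t, Sub t 3 t]"

text \<open>One of the two truncated differences vanishes, so their sum is the absolute difference,
  which is then clipped; \<open>s\<close> is scratch.\<close>

definition ne_i :: "nat \<Rightarrow> nat \<Rightarrow> nat \<Rightarrow> nat \<Rightarrow> instr list" where
  "ne_i t i j s = [Sub t i j, Sub s j i, Add t t s, Sub t 3 t, Sub t 3 t]"

lemmas instr_defs = get_i_def and_i_def or_i_def ne_i_def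

text \<open>An opaque copy of \<^const>\<open>of_bool\<close>, which the simplifier would split.\<close>

definition tv :: "bool \<Rightarrow> nat" where
  "tv p = of_bool p"

text \<open>The left-hand sides are what symbolic execution makes of \<open>and_i\<close>,
  \<open>or_i\<close> and \<open>ne_i\<close>.\<close>

lemma tv_arith:
  "tv p + tv q - Suc 0 = tv (p \<and> q)"
  "Suc 0 - (Suc 0 - (tv p + tv q)) = tv (p \<or> q)"
  "Suc 0 - (Suc 0 - ((i - j) + (j - i))) = tv (i \<noteq> j)"
  by (auto simp: tv_def)

lemma tv_le: "Suc 0 - (c - l) = tv (c \<le> l)"
  by (auto simp: tv_def)

text \<open>Registers 10, 12, 18, 20 hold \<open>u\<close>, \<open>v\<close>, \<open>a\<close>,
  \<open>b\<close>. The old mark of \<open>b\<close> enters by disjunction, so marks are never lost.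
  Register 25 is first scratch, then the address of that mark.\<close>

definition relax :: code where
  "relax = block (get_i 8 5 18 @ get_i 9 19 20 @ and_i 8 8 9 @
     ne_i 9 20 10 25 @ and_i 8 8 9 @ ne_i 9 20 12 25 @ and_i 8 8 9 @
     [Add 25 5 20, Load 9 25] @ or_i 8 8 9 @ [Store 25 8])"

text \<open>Register 20 runs through \<open>y\<close>. The conditions on \<open>u\<close>,
  \<open>v\<close>, \<open>x\<close> are already in register 24, and register 0 collects the
  disjunction over all candidates.\<close>

definition final :: code where
  "final = block (get_i 8 5 20 @ and_i 8 8 24 @ get_i 9 13 20 @ and_i 8 8 9 @
     ne_i 9 20 14 25 @ and_i 8 8 9 @ or_i 0 0 8)"

text \<open>The search from \<open>x\<close> runs even if \<open>u\<close>, \<open>v\<close>,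
  \<open>x\<close> do not qualify; register 24 suppresses its outcome at the end.\<close>

definition body_x :: code where
  "body_x = vfor 20 (block [Add 8 5 20, Const 9 0, Store 8 9]) ;;
     block ([Add 8 5 14, Store 8 3] @ get_i 8 11 14 @ ne_i 9 14 12 24 @ and_i 24 8 9 @ and_i 24 24 23) ;;
     vfor 16 (vfor 18 (vfor 20 relax)) ;; vfor 20 final"

text \<open>Register 22 accumulates \<open>cut_size E u v\<close>, starting from the matrix entry
  for \<open>uv\<close>. Register 23 receives the condition on \<open>u\<close> and \<open>v\<close>
  alone, with c \<le> k computed as 1 - (c - k).\<close>

definition body_uv :: code where
  "body_uv = block (get_i 22 11 12) ;;
     vfor 20 (block (get_i 8 11 20 @ get_i 9 13 20 @ and_i 8 8 9 @ [Add 22 22 8])) ;;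
     block (ne_i 8 10 12 9 @ [Sub 9 22 6, Sub 9 3 9] @ and_i 23 8 9) ;;
     vfor 14 body_x"

definition search :: code where
  "search = block [Const 0 0] ;; vfor 10 (vfor 12 body_uv)"

text \<open>After the matrix, the write pointer in register 28 is the base address of the marks;
  adding the 0 in register 29 copies it. The last loop stops when \<open>2 - symbol\<close>
  vanishes, that is, at the end of the input.\<close>

definition read_input :: code where
  "read_input = block [Const 2 0, Const 3 1] ;;
     repeat_while (block [Read 8, Add 2 2 8]) 8 ;;
     block [Const 28 40] ;;
     vfor 18 (vfor 20 (block [Read 8, Store 28 8, Add 28 28 3])) ;;
     block [Const 29 0, Add 5 28 29, Const 6 0, Const 25 0, Const 26 1, Const 27 0, Const 29 25, Const 30 2] ;;
     repeat_while (block [Read 8, Add 9 8 29, Load 9 9, Add 6 6 9, Add 26 26 26, Sub 8 30 8]) 8"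

section \<open>Invariants of the search for one triple \<open>u\<close>, \<open>v\<close>,
  \<open>x\<close>\<close>

locale mda =
  fixes n :: nat and E :: "nat set set" and k :: nat
  assumes graph: "simple_graph {..<n} E" and n_pos: "n > 0"
begin

lemma edge_bounds: "{a, b} \<in> E \<Longrightarrow> a < n" "{a, b} \<in> E \<Longrightarrow> b < n"
  using simple_graph_edgeD[OF graph] by auto

lemma cell_less: "a < n \<Longrightarrow> b < n \<Longrightarrow> a * n + b < n * n"
proof -
  assume "a < n" "b < n"
  then have "a * n + b < Suc a * n" by simp
  also have "\<dots> \<le> n * n" using \<open>a < n\<close> by (intro mult_le_mono) auto
  finally show ?thesis .
qed

definition env :: "(nat \<Rightarrow> nat) \<Rightarrow> bool" where
  "env X \<longleftrightarrow> X 2 = n \<and> X 3 = Suc 0 \<and> X 5 = 40 + n * n \<and> X 6 = k \<and>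
     (\<forall>a<n. \<forall>b<n. X (40 + a * n + b) = tv ({a, b} \<in> E))"

lemma env_regs:
  assumes "env X" shows "X 2 = n" "X 3 = Suc 0" "X 5 = 40 + n * n" "X 6 = k"
    "a < n \<Longrightarrow> b < n \<Longrightarrow> X (40 + a * n + b) = tv ({a, b} \<in> E)"
  using assms by (auto simp: env_def)

lemma env_upd [simp]:
  "r < 40 \<Longrightarrow> r \<noteq> 2 \<Longrightarrow> r \<noteq> 3 \<Longrightarrow> r \<noteq> 5 \<Longrightarrow> r \<noteq> 6 \<Longrightarrow> env (X(r := c)) = env X"
  by (simp add: env_def)

lemma env_upd_mark [simp]: "env (X(40 + n * n + b := c)) = env X"
proof -
  have "40 + a * n + d \<noteq> 40 + n * n + b" if "a < n" "d < n" for a d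
    using cell_less[OF that] by linarith
  then show ?thesis by (simp add: env_def)
qed

definition marks :: "(nat \<Rightarrow> bool) \<Rightarrow> (nat \<Rightarrow> nat) \<Rightarrow> bool" where
  "marks m X \<longleftrightarrow> (\<forall>b<n. X (40 + n * n + b) = tv (m b))"

lemma marksD: "marks m X \<Longrightarrow> b < n \<Longrightarrow> X (40 + n * n + b) = tv (m b)"
  by (simp add: marks_def)

lemma marks_upd [simp]: "r < 40 \<Longrightarrow> marks m (X(r := c)) = marks m X"
  by (simp add: marks_def)

lemma marks_upd_mark: "marks m X \<Longrightarrow> marks (m(b := v)) (X(40 + n * n + b := tv v))"
  by (simp add: marks_def)

lemma row_upd [simp]: "r \<noteq> i \<Longrightarrow> r \<noteq> Suc i \<Longrightarrow> row n (X(r := c)) i j = row n X i j"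
  by (simp add: row_def)

definition admissible :: "nat \<Rightarrow> nat \<Rightarrow> nat \<Rightarrow> nat \<Rightarrow> bool" where
  "admissible u v x y \<longleftrightarrow> u < n \<and> v < n \<and> u \<noteq> v \<and> cut_size E u v \<le> k \<and>
     {u, x} \<in> E \<and> x \<noteq> v \<and> y \<noteq> x \<and> {v, y} \<in> E"

text \<open>The marking is sound for reachability in any number of hops, but complete only for at most
  \<open>n\<close> hops. Proving no more about it avoids a separate argument that \<open>n\<close> hops always suffice:
  the path that a solution provides has at most \<open>n\<close> vertices.\<close>

definition result :: "(nat \<times> nat \<times> nat \<times> nat) set \<Rightarrow> (nat \<Rightarrow> nat) \<Rightarrow> bool" where
  "result D X \<longleftrightarrow> (\<exists>b. X 0 = tv b \<and>
     (b \<longrightarrow> (\<exists>u v x y. admissible u v x y \<and> (hop E u v)\<^sup>*\<^sup>* x y)) \<and>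
     (\<forall>u v x y i. (u, v, x, y) \<in> D \<longrightarrow> admissible u v x y \<longrightarrow> i \<le> n \<longrightarrow> (hop E u v ^^ i) x y \<longrightarrow> b))"

lemma result_upd [simp]: "r \<noteq> 0 \<Longrightarrow> result D (X(r := c)) = result D X"
  by (simp add: result_def)

text \<open>\<open>D\<close> is the set of quadruples examined so far. Only admissible ones matter,
  and these are bounded by \<open>n\<close>, so after a complete loop a range \<open>{..<n}\<close>
  may be widened to \<open>UNIV\<close>.\<close>

lemma result_mono:
  assumes "result D X"
    "\<And>u v x y. (u, v, x, y) \<in> D' \<Longrightarrow> admissible u v x y \<Longrightarrow> (u, v, x, y) \<in> D"
  shows "result D' X"
proof -
  from assms(1) obtain b where b: "X 0 = tv b"
    "b \<longrightarrow> (\<exists>u v x y. admissible u v x y \<and> (hop E u v)\<^sup>*\<^sup>* x y)"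
    "\<And>u v x y i. (u, v, x, y) \<in> D \<Longrightarrow> admissible u v x y \<Longrightarrow> i \<le> n \<Longrightarrow> (hop E u v ^^ i) x y \<Longrightarrow> b"
    unfolding result_def by blast
  have "\<forall>u v x y i. (u, v, x, y) \<in> D' \<longrightarrow> admissible u v x y \<longrightarrow> i \<le> n \<longrightarrow>
      (hop E u v ^^ i) x y \<longrightarrow> b"
    using b(3) assms(2) by blast
  with b(1,2) show ?thesis unfolding result_def by blast
qed

definition inst :: "nat \<Rightarrow> nat \<Rightarrow> nat \<Rightarrow> (nat \<times> nat \<times> nat \<times> nat) set \<Rightarrow> (nat \<Rightarrow> nat) \<Rightarrow> bool" where
  "inst u v x D X \<longleftrightarrow> env X \<and> row n X 10 u \<and> row n X 12 v \<and> row n X 14 x \<and>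
     X 23 = tv (u \<noteq> v \<and> cut_size E u v \<le> k) \<and>
     X 24 = tv (u \<noteq> v \<and> cut_size E u v \<le> k \<and> {u, x} \<in> E \<and> x \<noteq> v) \<and> result D X"

lemma inst_upd [simp]:
  "r < 40 \<Longrightarrow> r \<notin> {0, 2, 3, 5, 6, 10, 11, 12, 13, 14, 15, 23, 24} \<Longrightarrow>
     inst u v x D (X(r := c)) = inst u v x D X"
  "inst u v x D (X(40 + n * n + b := c)) = inst u v x D X"
  by (simp_all add: inst_def)

text \<open>The state of the marks in round \<open>r\<close>, when all pairs \<open>(c, d)\<close> that precede \<open>(a, b)\<close>
  lexicographically have been relaxed.\<close>

definition spread :: "nat \<Rightarrow> nat \<Rightarrow> nat \<Rightarrow> nat \<Rightarrow> nat \<Rightarrow> nat \<Rightarrow> (nat \<Rightarrow> bool) \<Rightarrow> bool" where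
  "spread u v x r a b m \<longleftrightarrow>
     (\<forall>y. m y \<longrightarrow> (hop E u v)\<^sup>*\<^sup>* x y) \<and> (\<forall>i\<le>r. \<forall>y. (hop E u v ^^ i) x y \<longrightarrow> m y) \<and>
     (\<forall>i\<le>r. \<forall>c d. (hop E u v ^^ i) x c \<longrightarrow> hop E u v c d \<longrightarrow> c < a \<or> c = a \<and> d < b \<longrightarrow> m d)"

text \<open>If \<open>a\<close> is within \<open>r\<close> hops of \<open>x\<close>, it is already
  marked, so relaxing \<open>(a, b)\<close> settles that pair. Marks set earlier in the same round
  may be used too; this is harmless, as soundness asks for reachability only.\<close>

lemma spread_relax:
  assumes "spread u v x r a b m"
  shows "spread u v x r a (Suc b) (m(b := m b \<or> m a \<and> hop E u v a b))"
  using assms unfolding spread_def by (auto simp: less_Suc_eq)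

text \<open>Every hop ends below \<open>n\<close>, so all hops from \<open>a\<close> have been
  handled.\<close>

lemma spread_next_row: "spread u v x r a n m \<Longrightarrow> spread u v x r (Suc a) 0 m"
  unfolding spread_def hop_def less_Suc_eq using edge_bounds by blast

text \<open>The last of \<open>Suc r\<close> hops is a pair that was relaxed, since all pairs
  precede \<open>(n, 0)\<close>.\<close>

lemma spread_next_round: 
  assumes "spread u v x r n 0 m" shows "spread u v x (Suc r) 0 0 m"
proof -
  have "m y" if "i \<le> Suc r" "(hop E u v ^^ i) x y" for i y
  proof (cases "i \<le> r")
    case False
    then have "i = Suc r" using that(1) by simp
    with that(2) have "(hop E u v ^^ Suc r) x y" by simp
    then obtain c where "(hop E u v ^^ r) x c" "hop E u v c y"
      by (rule relpowp_Suc_E)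
    moreover then have "c < n" using edge_bounds by (auto simp: hop_def)
    ultimately show ?thesis using assms unfolding spread_def by blast
  qed (use assms that in \<open>auto simp: spread_def\<close>)
  then show ?thesis using assms unfolding spread_def by auto
qed

lemma hoare_relax:
  assumes "a < n" "b < n"
  shows "hoare (\<lambda>X w. (inst u v x D X \<and> row n X 16 r \<and> row n X 18 a \<and> (\<exists>m. marks m X \<and> spread u v x r a b m)) \<and> row n X 20 b)
    relax 26
    (\<lambda>X w. (inst u v x D X \<and> row n X 16 r \<and> row n X 18 a \<and> (\<exists>m. marks m X \<and> spread u v x r a (Suc b) m)) \<and> row n X 20 b)"
  unfolding relax_def
proof (rule hoare_conseq[OF hoare_block])
  fix X w
  assume *: "(inst u v x D X \<and> row n X 16 r \<and> row n X 18 a \<and> (\<exists>m. marks m X \<and> spread u v x r a b m)) \<and> row n X 20 b"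
  then obtain m where m: "marks m X" "spread u v x r a b m" by blast
  have X: "X 3 = Suc 0" "X 5 = 40 + n * n" "X 10 = u" "X 12 = v" "X 18 = a" "X 19 = 40 + a * n" "X 20 = b"
    "X (40 + a * n + b) = tv ({a, b} \<in> E)"
    "X (40 + n * n + a) = tv (m a)" "X (40 + n * n + b) = tv (m b)"
    using * m assms by (auto simp: inst_def row_def env_regs marksD)
  let ?v = "m b \<or> m a \<and> hop E u v a b"
  have v: "tv (m a \<and> {a, b} \<in> E \<and> b \<noteq> u \<and> b \<noteq> v \<or> m b) = tv ?v"
    by (rule arg_cong[of _ _ tv]) (auto simp: hop_def)
  have "\<exists>m. marks m (Y(40 + n * n + b := tv ?v)) \<and> spread u v x r a (Suc b) m" if "marks m Y" for Y
    using marks_upd_mark[OF that] spread_relax[OF m(2)] by blast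
  then show "case fold eff (get_i 8 5 18 @ get_i 9 19 20 @ and_i 8 8 9 @
     ne_i 9 20 10 25 @ and_i 8 8 9 @ ne_i 9 20 12 25 @ and_i 8 8 9 @
     [Add 25 5 20, Load 9 25] @ or_i 8 8 9 @ [Store 25 8]) (X, w) of (X, w) \<Rightarrow>
     (inst u v x D X \<and> row n X 16 r \<and> row n X 18 a \<and> (\<exists>m. marks m X \<and> spread u v x r a (Suc b) m)) \<and> row n X 20 b"
    using * m(1) by (simp add: instr_defs X tv_arith v)
qed (auto simp: instr_defs)

lemma hoare_round:
  "hoare (\<lambda>X w. (inst u v x D X \<and> (\<exists>m. marks m X \<and> spread u v x r 0 0 m)) \<and> row n X 16 r)
    (vfor 18 (vfor 20 relax)) (2 + n * ((2 + n * 30) + 4))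
    (\<lambda>X w. (inst u v x D X \<and> (\<exists>m. marks m X \<and> spread u v x (Suc r) 0 0 m)) \<and> row n X 16 r)"
proof -
  have 1: "hoare (\<lambda>X w. inst u v x D X \<and> row n X 16 r \<and> row n X 18 a \<and> (\<exists>m. marks m X \<and> spread u v x r a 0 m))
      (vfor 20 relax) (2 + n * (26 + 4))
      (\<lambda>X w. inst u v x D X \<and> row n X 16 r \<and> row n X 18 a \<and> (\<exists>m. marks m X \<and> spread u v x r a n m))"
    if "a < n" for a
    using n_pos hoare_relax[OF that]
    by (intro hoare_vfor[where I = "\<lambda>b X w. inst u v x D X \<and> row n X 16 r \<and> row n X 18 a \<and>
          (\<exists>m. marks m X \<and> spread u v x r a b m)"]) (auto simp: inst_def env_regs)
  have "hoare (\<lambda>X w. inst u v x D X \<and> row n X 16 r \<and> (\<exists>m. marks m X \<and> spread u v x r 0 0 m))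
    (vfor 18 (vfor 20 relax)) (2 + n * ((2 + n * 30) + 4))
    (\<lambda>X w. inst u v x D X \<and> row n X 16 r \<and> (\<exists>m. marks m X \<and> spread u v x r n 0 m))"
  proof (rule hoare_vfor[where I = "\<lambda>a X w. inst u v x D X \<and> row n X 16 r \<and>
          (\<exists>m. marks m X \<and> spread u v x r a 0 m)"])
    fix a assume "a < n"
    from 1[OF this] show "hoare (\<lambda>X w. (inst u v x D X \<and> row n X 16 r \<and>
          (\<exists>m. marks m X \<and> spread u v x r a 0 m)) \<and> row n X 18 a) (vfor 20 relax) (2 + n * 30)
        (\<lambda>X w. (inst u v x D X \<and> row n X 16 r \<and>
          (\<exists>m. marks m X \<and> spread u v x r (Suc a) 0 m)) \<and> row n X 18 a)"
      by (rule hoare_conseq) (auto dest: spread_next_row)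
  qed (use n_pos in \<open>auto simp: inst_def env_regs\<close>)
  then show ?thesis
    by (rule hoare_conseq) (auto dest: spread_next_round)
qed

lemma hoare_rounds:
  "hoare (\<lambda>X w. inst u v x D X \<and> marks (\<lambda>b. b = x) X) (vfor 16 (vfor 18 (vfor 20 relax)))
    (2 + n * ((2 + n * ((2 + n * 30) + 4)) + 4))
    (\<lambda>X w. inst u v x D X \<and> (\<exists>m. marks m X \<and> spread u v x n 0 0 m))"
proof (rule hoare_conseq[OF hoare_vfor[where
      I = "\<lambda>r X w. inst u v x D X \<and> (\<exists>m. marks m X \<and> spread u v x r 0 0 m)"]])
  show "hoare (\<lambda>X w. (inst u v x D X \<and> (\<exists>m. marks m X \<and> spread u v x r 0 0 m)) \<and> row n X 16 r)
    (vfor 18 (vfor 20 relax)) (2 + n * ((2 + n * 30) + 4))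
    (\<lambda>X w. (inst u v x D X \<and> (\<exists>m. marks m X \<and> spread u v x (Suc r) 0 0 m)) \<and> row n X 16 r)" for r
    by (rule hoare_round)
next
  fix X assume "inst u v x D X \<and> marks (\<lambda>b. b = x) X"
  moreover have "spread u v x 0 0 0 (\<lambda>b. b = x)" by (auto simp: spread_def)
  ultimately show "inst u v x D X \<and> (\<exists>m. marks m X \<and> spread u v x 0 0 0 m)" by blast
qed (use n_pos in \<open>auto simp: inst_def env_regs\<close>)

lemma result_or:
  assumes "result D X" "X 0 = tv b"
    and "c \<Longrightarrow> admissible u v x y \<and> (hop E u v)\<^sup>*\<^sup>* x y"
    and "\<And>i. admissible u v x y \<Longrightarrow> i \<le> n \<Longrightarrow> (hop E u v ^^ i) x y \<Longrightarrow> c"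
    and "Y 0 = tv (b \<or> c)"
  shows "result (insert (u, v, x, y) D) Y"
proof -
  \<comment> \<open>\<open>result\<close> hides its truth value behind a quantifier; injectivity
    identifies it with \<open>b\<close>.\<close>
  have tv: "tv p = tv q \<Longrightarrow> p = q" for p q by (cases p; cases q) (simp_all add: tv_def)
  from assms(1) have "b \<longrightarrow> (\<exists>u v x y. admissible u v x y \<and> (hop E u v)\<^sup>*\<^sup>* x y)"
    "\<And>u v x y i. (u, v, x, y) \<in> D \<Longrightarrow> admissible u v x y \<Longrightarrow> i \<le> n \<Longrightarrow> (hop E u v ^^ i) x y \<Longrightarrow> b"
    unfolding result_def assms(2) by (blast dest: tv)+
  then show ?thesis unfolding result_def using assms(3-) by (intro exI[of _ "b \<or> c"]) blast
qed

lemma hoare_final: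
  assumes "u < n" "v < n" "x < n"
  shows "hoare (\<lambda>X w. inst u v x D X \<and> (\<exists>m. marks m X \<and> spread u v x n 0 0 m)) (vfor 20 final)
    (2 + n * 22)
    (\<lambda>X w. inst u v x (D \<union> {u} \<times> {v} \<times> {x} \<times> {..<n}) X)"
proof -
  let ?I = "\<lambda>y X w. inst u v x (D \<union> {u} \<times> {v} \<times> {x} \<times> {..<y}) X \<and>
    (\<exists>m. marks m X \<and> spread u v x n 0 0 m)"
  have "hoare (\<lambda>X w. ?I y X w \<and> row n X 20 y) final 18 (\<lambda>X w. ?I (Suc y) X w \<and> row n X 20 y)"
    if y: "y < n" for y
    unfolding final_def
  proof (rule hoare_conseq[OF hoare_block])
    fix X w assume *: "?I y X w \<and> row n X 20 y"
    then obtain m where m: "marks m X" "spread u v x n 0 0 m" by blast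
    obtain b where b: "X 0 = tv b" using * by (auto simp: inst_def result_def)
    let ?flag = "u \<noteq> v \<and> cut_size E u v \<le> k \<and> {u, x} \<in> E \<and> x \<noteq> v"
    have X: "X 3 = Suc 0" "X 5 = 40 + n * n" "X 13 = 40 + v * n" "X 14 = x" "X 20 = y"
      "X 24 = tv ?flag" "X (40 + v * n + y) = tv ({v, y} \<in> E)" "X (40 + n * n + y) = tv (m y)"
      using * m y assms by (auto simp: inst_def row_def env_regs marksD)
    let ?c = "((m y \<and> ?flag) \<and> {v, y} \<in> E) \<and> y \<noteq> x"
    have D: "insert (u, v, x, y) (D \<union> {u} \<times> {v} \<times> {x} \<times> {..<y}) = D \<union> {u} \<times> {v} \<times> {x} \<times> {..<Suc y}"
      by auto
    have "result (D \<union> {u} \<times> {v} \<times> {x} \<times> {..<Suc y}) Y" if "Y 0 = tv (b \<or> ?c)" for Y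
      unfolding D[symmetric]
    proof (rule result_or[where X = X and b = b and c = ?c])
      \<comment> \<open>Soundness is the first clause of \<open>spread\<close>, completeness the
        second one after \<open>n\<close> rounds.\<close>
      show "admissible u v x y \<and> (hop E u v)\<^sup>*\<^sup>* x y" if ?c
        using that m(2) assms by (auto simp: admissible_def spread_def)
      show ?c if "admissible u v x y" "i \<le> n" "(hop E u v ^^ i) x y" for i
        using that m(2) by (auto simp: admissible_def spread_def)
    qed (use * b that in \<open>auto simp: inst_def\<close>)
    then have "inst u v x (D \<union> {u} \<times> {v} \<times> {x} \<times> {..<Suc y}) (Y(0 := tv (b \<or> ?c)))"
      if "inst u v x (D \<union> {u} \<times> {v} \<times> {x} \<times> {..<y}) Y" for Y
      using that by (simp add: inst_def)
    then show "case fold eff (get_i 8 5 20 @ and_i 8 8 24 @ get_i 9 13 20 @ and_i 8 8 9 @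
     ne_i 9 20 14 25 @ and_i 8 8 9 @ or_i 0 0 8) (X, w) of (X, w) \<Rightarrow> ?I (Suc y) X w \<and> row n X 20 y"
      using * by (simp add: instr_defs X b tv_arith)
  qed (auto simp: instr_defs)
  then have "hoare (?I 0) (vfor 20 final) (2 + n * (18 + 4)) (?I n)"
    by (intro hoare_vfor[where I = ?I]) (use n_pos in \<open>auto simp: inst_def env_regs\<close>)
  then show ?thesis by (rule hoare_conseq) auto
qed

end


text \<open>Shaped like the sums that \<open>hoare_sequ\<close> and \<open>hoare_vfor\<close>
  produce, so that the triples fit without arithmetic.\<close>

definition time_x :: "nat \<Rightarrow> nat" where
  "time_x n = (2 + n * 7) + (13 + ((2 + n * ((2 + n * ((2 + n * 30) + 4)) + 4)) + (2 + n * 22)))"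

definition time_uv :: "nat \<Rightarrow> nat" where
  "time_uv n = 2 + ((2 + n * (7 + 4)) + (9 + (2 + n * (time_x n + 4))))"

definition time_search :: "nat \<Rightarrow> nat" where
  "time_search n = 1 + (2 + n * ((2 + n * (time_uv n + 4)) + 4))"

section \<open>Assembling the search\<close>

context mda
begin

definition pair_env :: "nat \<Rightarrow> nat \<Rightarrow> (nat \<Rightarrow> nat) \<Rightarrow> bool" where
  "pair_env u v X \<longleftrightarrow> env X \<and> row n X 10 u \<and> row n X 12 v \<and>
     X 23 = tv (u \<noteq> v \<and> cut_size E u v \<le> k)"

lemma pair_env_upd [simp]:
  "r < 40 \<Longrightarrow> r \<notin> {2, 3, 5, 6, 10, 11, 12, 13, 23} \<Longrightarrow> pair_env u v (X(r := c)) = pair_env u v X"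
  "pair_env u v (X(40 + n * n + b := c)) = pair_env u v X"
  by (simp_all add: pair_env_def)

lemma hoare_clear:
  "hoare (\<lambda>X w. pair_env u v X \<and> result D X \<and> row n X 14 x)
    (vfor 20 (block [Add 8 5 20, Const 9 0, Store 8 9])) (2 + n * 7)
    (\<lambda>X w. pair_env u v X \<and> result D X \<and> row n X 14 x \<and> marks (\<lambda>_. False) X)"
proof -
  let ?I = "\<lambda>b X w. (pair_env u v X \<and> result D X \<and> row n X 14 x) \<and> (\<forall>c<b. X (40 + n * n + c) = 0)"
  have "hoare (\<lambda>X w. ?I b X w \<and> row n X 20 b) (block [Add 8 5 20, Const 9 0, Store 8 9]) 3
      (\<lambda>X w. ?I (Suc b) X w \<and> row n X 20 b)" for b
  proof (rule hoare_conseq[OF hoare_block])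
    fix X w assume *: "?I b X w \<and> row n X 20 b"
    then have "X 5 = 40 + n * n" "X 20 = b" by (auto simp: pair_env_def env_regs row_def)
    with * show "case fold eff [Add 8 5 20, Const 9 0, Store 8 9] (X, w) of
        (X, w) \<Rightarrow> ?I (Suc b) X w \<and> row n X 20 b"
      by (auto simp: less_Suc_eq)
  qed auto
  then have "hoare (?I 0) (vfor 20 (block [Add 8 5 20, Const 9 0, Store 8 9])) (2 + n * (3 + 4)) (?I n)"
    by (intro hoare_vfor[where I = ?I]) (use n_pos in \<open>auto simp: pair_env_def env_regs\<close>)
  then show ?thesis by (rule hoare_conseq) (auto simp: marks_def tv_def)
qed

lemma hoare_start:
  assumes "u < n" "x < n"
  shows "hoare (\<lambda>X w. pair_env u v X \<and> result D X \<and> row n X 14 x \<and> marks (\<lambda>_. False) X)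
    (block ([Add 8 5 14, Store 8 3] @ get_i 8 11 14 @ ne_i 9 14 12 24 @ and_i 24 8 9 @ and_i 24 24 23)) 13
    (\<lambda>X w. inst u v x D X \<and> marks (\<lambda>b. b = x) X)"
proof (rule hoare_conseq[OF hoare_block])
  fix X w assume *: "pair_env u v X \<and> result D X \<and> row n X 14 x \<and> marks (\<lambda>_. False) X"
  \<comment> \<open>The matrix entry is read after the mark of \<open>x\<close> was stored; the last
    two facts let the simplifier see that the two addresses differ.\<close>
  from * have X: "X 3 = Suc 0" "X 5 = 40 + n * n" "X 11 = 40 + u * n" "X 12 = v" "X 14 = x"
    "X 23 = tv (u \<noteq> v \<and> cut_size E u v \<le> k)"
    "X (40 + u * n + x) = tv ({u, x} \<in> E)" "u \<noteq> n" "n \<noteq> 0"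
    using assms by (auto simp: pair_env_def row_def env_regs)
  have "marks ((\<lambda>_. False)(x := True)) (Y(40 + n * n + x := Suc 0))" if "marks (\<lambda>_. False) Y" for Y
    using marks_upd_mark[OF that, of x True] by (simp add: tv_def)
  moreover have "(\<lambda>_. False)(x := True) = (\<lambda>b. b = x)" by (simp add: fun_eq_iff)
  ultimately have "marks (\<lambda>b. b = x) (Y(40 + n * n + x := Suc 0))" if "marks (\<lambda>_. False) Y" for Y
    using that by simp
  moreover have "tv (({u, x} \<in> E \<and> x \<noteq> v) \<and> u \<noteq> v \<and> cut_size E u v \<le> k) =
      tv (u \<noteq> v \<and> cut_size E u v \<le> k \<and> {u, x} \<in> E \<and> x \<noteq> v)"
    by (rule arg_cong[of _ _ tv]) auto
  ultimately show "case fold eff ([Add 8 5 14, Store 8 3] @ get_i 8 11 14 @ ne_i 9 14 12 24 @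
      and_i 24 8 9 @ and_i 24 24 23) (X, w) of (X, w) \<Rightarrow> inst u v x D X \<and> marks (\<lambda>b. b = x) X"
    using * by (simp add: instr_defs X tv_arith inst_def pair_env_def)
qed (auto simp: instr_defs)

lemma hoare_body_x:
  assumes "u < n" "v < n" "x < n"
  shows "hoare (\<lambda>X w. pair_env u v X \<and> result D X \<and> row n X 14 x) body_x (time_x n)
    (\<lambda>X w. pair_env u v X \<and> result (D \<union> {u} \<times> {v} \<times> {x} \<times> UNIV) X \<and> row n X 14 x)"
proof -
  have "hoare (\<lambda>X w. pair_env u v X \<and> result D X \<and> row n X 14 x) body_x (time_x n)
    (\<lambda>X w. inst u v x (D \<union> {u} \<times> {v} \<times> {x} \<times> {..<n}) X)"
    unfolding body_x_def time_x_def
    by (intro hoare_sequ[OF hoare_clear] hoare_sequ[OF hoare_start[OF assms(1,3)]]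
        hoare_sequ[OF hoare_rounds] hoare_final assms)
  then show ?thesis
    by (rule hoare_conseq)
      (auto simp: inst_def pair_env_def admissible_def elim!: result_mono dest: edge_bounds)
qed

lemma hoare_body_uv:
  assumes u: "u < n" and v: "v < n"
  shows "hoare (\<lambda>X w. env X \<and> row n X 10 u \<and> result D X \<and> row n X 12 v) body_uv (time_uv n)
    (\<lambda>X w. env X \<and> row n X 10 u \<and> result (D \<union> {u} \<times> {v} \<times> UNIV \<times> UNIV) X \<and> row n X 12 v)"
proof -
  let ?P = "\<lambda>X. env X \<and> row n X 10 u \<and> result D X \<and> row n X 12 v"
  \<comment> \<open>The partial value of \<open>cut_size E u v\<close> that counts the common
    neighbours below \<open>w\<close>.\<close>
  let ?C = "\<lambda>w. of_bool ({u, v} \<in> E) + card {w'. w' < w \<and> {u, w'} \<in> E \<and> {v, w'} \<in> E}"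
  let ?I = "\<lambda>w X _. ?P X \<and> X 22 = ?C w"
  have 1: "hoare (\<lambda>X w. ?P X) (block (get_i 22 11 12)) 2 (?I 0)"
  proof (rule hoare_conseq[OF hoare_block])
    fix X w assume *: "?P X"
    then have "X 11 = 40 + u * n" "X 12 = v" "X (40 + u * n + v) = of_bool ({u, v} \<in> E)"
      using assms by (auto simp: row_def env_regs tv_def)
    with * show "case fold eff (get_i 22 11 12) (X, w) of (X, w) \<Rightarrow> ?I 0 X w"
      by (simp add: get_i_def)
  qed (auto simp: instr_defs)
  have "hoare (\<lambda>X a. ?I w X a \<and> row n X 20 w)
      (block (get_i 8 11 20 @ get_i 9 13 20 @ and_i 8 8 9 @ [Add 22 22 8])) 7
      (\<lambda>X a. ?I (Suc w) X a \<and> row n X 20 w)" if "w < n" for w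
  proof (rule hoare_conseq[OF hoare_block])
    fix X a assume *: "?I w X a \<and> row n X 20 w"
    then have X: "X 3 = Suc 0" "X 11 = 40 + u * n" "X 13 = 40 + v * n" "X 20 = w"
      "X (40 + u * n + w) = tv ({u, w} \<in> E)" "X (40 + v * n + w) = tv ({v, w} \<in> E)" "X 22 = ?C w"
      using assms that by (auto simp: row_def env_regs)
    have "{w'. w' < Suc w \<and> {u, w'} \<in> E \<and> {v, w'} \<in> E} =
        (if {u, w} \<in> E \<and> {v, w} \<in> E then insert w else id) {w'. w' < w \<and> {u, w'} \<in> E \<and> {v, w'} \<in> E}"
      by (auto simp: less_Suc_eq)
    then have "?C (Suc w) = ?C w + tv ({u, w} \<in> E \<and> {v, w} \<in> E)"
      by (simp add: tv_def)
    then show "case fold eff (get_i 8 11 20 @ get_i 9 13 20 @ and_i 8 8 9 @ [Add 22 22 8]) (X, a) of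
        (X, a) \<Rightarrow> ?I (Suc w) X a \<and> row n X 20 w"
      using * by (simp add: instr_defs X tv_arith)
  qed (auto simp: instr_defs)
  then have 2: "hoare (?I 0) (vfor 20 (block (get_i 8 11 20 @ get_i 9 13 20 @ and_i 8 8 9 @ [Add 22 22 8])))
      (2 + n * (7 + 4)) (?I n)"
    by (intro hoare_vfor[where I = ?I]) (use n_pos in \<open>auto simp: env_regs\<close>)
  have "{w'. w' < n \<and> {u, w'} \<in> E \<and> {v, w'} \<in> E} = {w'. {u, w'} \<in> E \<and> {v, w'} \<in> E}"
    by (auto dest: edge_bounds)
  then have C: "?C n = cut_size E u v" by (simp add: cut_size_def)
  have 3: "hoare (?I n) (block (ne_i 8 10 12 9 @ [Sub 9 22 6, Sub 9 3 9] @ and_i 23 8 9)) 9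
      (\<lambda>X w. pair_env u v X \<and> result D X)"
    unfolding C
  proof (rule hoare_conseq[OF hoare_block])
    fix X w assume *: "?P X \<and> X 22 = cut_size E u v"
    then have X: "X 3 = Suc 0" "X 6 = k" "X 10 = u" "X 12 = v" "X 22 = cut_size E u v"
      by (auto simp: row_def env_regs)
    \<comment> \<open>\<open>tv_le\<close> is instantiated because its general left-hand side also
      matches the clipping 1 - (1 - s).\<close>
    show "case fold eff (ne_i 8 10 12 9 @ [Sub 9 22 6, Sub 9 3 9] @ and_i 23 8 9) (X, w) of
        (X, w) \<Rightarrow> pair_env u v X \<and> result D X"
      using * by (simp add: instr_defs X tv_arith(3) tv_le[of "cut_size E u v"])
        (simp add: tv_arith pair_env_def)
  qed (auto simp: instr_defs)
  let ?J = "\<lambda>x X w. pair_env u v X \<and> result (D \<union> {u} \<times> {v} \<times> {..<x} \<times> UNIV) X"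
  have D: "D \<union> {u} \<times> {v} \<times> {..<x} \<times> UNIV \<union> {u} \<times> {v} \<times> {x} \<times> UNIV =
      D \<union> {u} \<times> {v} \<times> {..<Suc x} \<times> (UNIV :: nat set)" for x :: nat
    by auto
  have "hoare (\<lambda>X w. ?J x X w \<and> row n X 14 x) body_x (time_x n) (\<lambda>X w. ?J (Suc x) X w \<and> row n X 14 x)"
    if "x < n" for x
    by (rule hoare_conseq[OF hoare_body_x[OF assms that, of "D \<union> {u} \<times> {v} \<times> {..<x} \<times> UNIV", unfolded D]]) auto
  then have "hoare (?J 0) (vfor 14 body_x) (2 + n * (time_x n + 4)) (?J n)"
    by (intro hoare_vfor[where I = ?J]) (use n_pos in \<open>auto simp: pair_env_def env_regs\<close>)
  then have 4: "hoare (\<lambda>X w. pair_env u v X \<and> result D X) (vfor 14 body_x) (2 + n * (time_x n + 4))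
      (\<lambda>X w. env X \<and> row n X 10 u \<and> result (D \<union> {u} \<times> {v} \<times> UNIV \<times> UNIV) X \<and> row n X 12 v)"
    by (rule hoare_conseq)
      (auto simp: pair_env_def admissible_def elim!: result_mono dest: edge_bounds)
  show ?thesis
    unfolding body_uv_def time_uv_def by (intro hoare_sequ[OF 1] hoare_sequ[OF 2] hoare_sequ[OF 3] 4)
qed

lemma hoare_search:
  "hoare (\<lambda>X w. env X) search (time_search n) (\<lambda>X w. result UNIV X)"
proof -
  let ?I = "\<lambda>u X w. env X \<and> result ({..<u} \<times> UNIV) X"
  let ?J = "\<lambda>u v X w. env X \<and> row n X 10 u \<and> result ({..<u} \<times> UNIV \<union> {u} \<times> {..<v} \<times> UNIV \<times> UNIV) X"
  have 1: "hoare (\<lambda>X w. env X) (block [Const 0 0]) 1 (?I 0)"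
    by (rule hoare_conseq[OF hoare_block[where P = "\<lambda>X w. env X"]]) (auto simp: result_def tv_def)
  have D: "{..<u} \<times> UNIV \<union> {u} \<times> {..<v} \<times> UNIV \<times> UNIV \<union> {u} \<times> {v} \<times> UNIV \<times> UNIV =
      {..<u} \<times> UNIV \<union> {u} \<times> {..<Suc v} \<times> UNIV \<times> (UNIV :: nat set)" for u v :: nat
    by auto
  have "hoare (\<lambda>X w. ?I u X w \<and> row n X 10 u) (vfor 12 body_uv) (2 + n * (time_uv n + 4))
      (\<lambda>X w. ?I (Suc u) X w \<and> row n X 10 u)" if u: "u < n" for u
  proof -
    have "hoare (\<lambda>X w. ?J u v X w \<and> row n X 12 v) body_uv (time_uv n)
        (\<lambda>X w. ?J u (Suc v) X w \<and> row n X 12 v)" if "v < n" for v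
      by (rule hoare_conseq[OF hoare_body_uv[OF u that,
            of "{..<u} \<times> UNIV \<union> {u} \<times> {..<v} \<times> UNIV \<times> UNIV", unfolded D]]) auto
    then have "hoare (?J u 0) (vfor 12 body_uv) (2 + n * (time_uv n + 4)) (?J u n)"
      by (intro hoare_vfor[where I = "?J u"]) (use n_pos in \<open>auto simp: env_regs\<close>)
    then show ?thesis
      by (rule hoare_conseq) (auto simp: admissible_def less_Suc_eq elim!: result_mono)
  qed
  then have "hoare (?I 0) (vfor 10 (vfor 12 body_uv)) (2 + n * ((2 + n * (time_uv n + 4)) + 4)) (?I n)"
    by (intro hoare_vfor[where I = ?I]) (use n_pos in \<open>auto simp: env_regs\<close>)
  from hoare_sequ[OF 1 this] show ?thesis
    unfolding search_def time_search_def
    by (rule hoare_conseq) (auto simp: admissible_def elim!: result_mono)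
qed

text \<open>The two guarantees of \<open>result\<close> fit the two graph lemmas: a solution is
  built from walks of any length, and a given solution yields at most \<open>n\<close> hops.\<close>

lemma result_correct:
  assumes "result UNIV X" and conn: "connected_graph {..<n} E"
  shows "X 0 \<noteq> 0 \<longleftrightarrow> mda_question 3 (n, E, k)"
proof -
  obtain b where b: "X 0 = tv b"
    "b \<Longrightarrow> \<exists>u v x y. admissible u v x y \<and> (hop E u v)\<^sup>*\<^sup>* x y"
    "\<And>u v x y i. admissible u v x y \<Longrightarrow> i \<le> n \<Longrightarrow> (hop E u v ^^ i) x y \<Longrightarrow> b"
    using assms(1) unfolding result_def by blast
  have "b \<longleftrightarrow> mda_question 3 (n, E, k)"
  proof
    assume b
    then obtain u v x y where uv: "admissible u v x y" "(hop E u v)\<^sup>*\<^sup>* x y"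
      using b(2) by blast
    then obtain F where "F \<subseteq> E" "card F \<le> cut_size E u v"
      "connected_graph {..<n} (E - F)" "3 \<le> graph_diam {..<n} (E - F)"
      using augmentation_exists[OF graph conn, of u v x y] by (auto simp: admissible_def)
    moreover have "cut_size E u v \<le> k" using uv(1) by (simp add: admissible_def)
    ultimately show "mda_question 3 (n, E, k)" by auto
  next
    assume "mda_question 3 (n, E, k)"
    then obtain F where F: "F \<subseteq> E" "card F \<le> k" "connected_graph {..<n} (E - F)"
      "3 \<le> graph_diam {..<n} (E - F)" by auto
    show b
    proof (rule augmentation_necessary[OF graph F(1,3,4)])
      fix u v x y m
      assume "u \<in> {..<n}" "v \<in> {..<n}" "u \<noteq> v" "{u, x} \<in> E" "x \<noteq> v"
        and m: "(hop E u v ^^ m) x y" "m \<le> card {..<n}"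
        and "y \<noteq> x" "{v, y} \<in> E" "cut_size E u v \<le> card F"
      then have "admissible u v x y" using F(2) by (simp add: admissible_def)
      then show b using b(3) m by simp
    qed
  qed
  moreover have "X 0 \<noteq> 0 \<longleftrightarrow> b" using b(1) by (simp add: tv_def)
  ultimately show ?thesis by (rule trans[rotated])
qed

end


section \<open>Reading the input\<close>

text \<open>Writing the unread input as \<open>drop j w\<close> lets loop invariants refer to one
  fixed word.\<close>

lemma eff_Read_drop:
  "j < length w \<Longrightarrow> eff (Read i) (X, drop j w) = (X(i := of_bool (w ! j)), drop (Suc j) w)"
  by (simp flip: Cons_nth_drop_Suc)

definition matrix :: "nat \<Rightarrow> nat set set \<Rightarrow> bool list" where
  "matrix n E = concat (map (\<lambda>u. map (\<lambda>v. {u, v} \<in> E) [0..<n]) [0..<n])"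

lemma length_matrix: "length (matrix n E) = n * n"
  by (simp add: matrix_def length_concat o_def sum_list_triv)

lemma nth_matrix:
  assumes "a < n" "b < n"
  shows "matrix n E ! (a * n + b) \<longleftrightarrow> {a, b} \<in> E"
proof -
  \<comment> \<open>The number \<open>m\<close> of rows is separated from their length
    \<open>n\<close> to allow induction on the rows.\<close>
  have "concat (map (\<lambda>u. map (f u) [0..<n]) [0..<m]) ! (a * n + b) = f a b"
    if "a < m" for f :: "nat \<Rightarrow> nat \<Rightarrow> bool" and m
    using that
  proof (induction m)
    case (Suc m)
    have len: "length (concat (map (\<lambda>u. map (f u) [0..<n]) [0..<m])) = m * n"
      by (simp add: length_concat o_def sum_list_triv)
    show ?case
    proof (cases "a < m")
      case True
      have "a * n + b < Suc a * n" using assms(2) by simp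
      also have "\<dots> \<le> m * n" using True by (intro mult_le_mono) auto
      finally show ?thesis using Suc.IH[OF True] len by (simp add: nth_append)
    next
      case False
      then have "a = m" using Suc.prems by simp
      then show ?thesis using len assms(2) by (simp add: nth_append)
    qed
  qed simp
  from this[OF assms(1), of "\<lambda>u v. {u, v} \<in> E"] show ?thesis by (simp add: matrix_def)
qed

definition time_read :: "nat \<Rightarrow> nat \<Rightarrow> nat" where
  "time_read n l = 2 + ((n + 1) * 3 + (1 + ((2 + n * ((2 + n * 7) + 4)) + (8 + (l + 1) * 7))))"

context mda
begin

lemma hoare_read_unary:
  "hoare (\<lambda>X w. X 2 = 0 \<and> X 3 = Suc 0 \<and> w = replicate n True @ False # w0)
    (repeat_while (block [Read 8, Add 2 2 8]) 8) ((n + 1) * 3)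
    (\<lambda>X w. X 2 = n \<and> X 3 = Suc 0 \<and> w = w0)"
proof -
  let ?w = "replicate n True @ False # w0"
  \<comment> \<open>There are \<open>n + 1\<close> rounds; the last one reads the separator and adds
    0, hence the minimum.\<close>
  let ?I = "\<lambda>j X w. X 2 = min j n \<and> X 3 = Suc 0 \<and> w = drop j ?w"
  have "hoare (?I j) (block [Read 8, Add 2 2 8]) 2
      (\<lambda>X w. ?I (Suc j) X w \<and> (X 8 > 0 \<longleftrightarrow> Suc j < n + 1))" if "j < n + 1" for j
  proof (rule hoare_conseq[OF hoare_block])
    fix X :: "nat \<Rightarrow> nat" and w assume *: "?I j X w"
    have "?w ! j \<longleftrightarrow> j < n" "j < length ?w" using that by (auto simp: nth_append)
    then show "case fold eff [Read 8, Add 2 2 8] (X, w) of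
        (X, w) \<Rightarrow> ?I (Suc j) X w \<and> (X 8 > 0 \<longleftrightarrow> Suc j < n + 1)"
      using * that eff_Read_drop[of j ?w 8 X] by (auto simp del: drop_append drop_Suc_Cons)
  qed auto
  then have "hoare (?I 0) (repeat_while (block [Read 8, Add 2 2 8]) 8) ((n + 1) * Suc 2) (?I (n + 1))"
    by (rule hoare_repeat_while) auto
  then show ?thesis by (rule hoare_conseq) auto
qed

lemma hoare_read_matrix:
  "hoare (\<lambda>X w. X 2 = n \<and> X 3 = Suc 0 \<and> X 28 = 40 \<and> w = matrix n E @ w0)
    (vfor 18 (vfor 20 (block [Read 8, Store 28 8, Add 28 28 3]))) (2 + n * ((2 + n * 7) + 4))
    (\<lambda>X w. X 2 = n \<and> X 3 = Suc 0 \<and> X 28 = 40 + n * n \<and> w = w0 \<and>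
      (\<forall>a<n. \<forall>b<n. X (40 + a * n + b) = tv ({a, b} \<in> E)))"
proof -
  let ?M = "matrix n E"
  \<comment> \<open>One invariant in the linear index \<open>i\<close> serves both loops, with
    \<open>a * n + b\<close> and \<open>a * n\<close> for \<open>i\<close>.\<close>
  let ?I = "\<lambda>i X w. X 2 = n \<and> X 3 = Suc 0 \<and> X 28 = 40 + i \<and>
    (\<forall>l<i. X (40 + l) = of_bool (?M ! l)) \<and> w = drop i (?M @ w0)"
  let ?B = "block [Read 8, Store 28 8, Add 28 28 3]"
  let ?J = "\<lambda>a b X w. ?I (a * n + b) X w \<and> row n X 18 a"
  have "hoare (\<lambda>X w. ?J a b X w \<and> row n X 20 b) ?B 3 (\<lambda>X w. ?J a (Suc b) X w \<and> row n X 20 b)"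
    if "a < n" "b < n" for a b
  proof (rule hoare_conseq[OF hoare_block])
    fix X w assume *: "?J a b X w \<and> row n X 20 b"
    let ?i = "a * n + b"
    have "?i < length ?M" using cell_less[OF that] by (simp add: length_matrix)
    then have "eff (Read 8) (X, w) = (X(8 := of_bool (?M ! ?i)), drop (Suc ?i) (?M @ w0))"
      using eff_Read_drop[of ?i "?M @ w0" 8 X] * by (simp add: nth_append)
    with * show "case fold eff [Read 8, Store 28 8, Add 28 28 3] (X, w) of
        (X, w) \<Rightarrow> ?J a (Suc b) X w \<and> row n X 20 b"
      by (auto simp: less_Suc_eq simp del: drop_append)
  qed auto
  then have 1: "hoare (?J a 0) (vfor 20 ?B) (2 + n * (3 + 4)) (?J a n)" if "a < n" for a
    using that by (intro hoare_vfor[where I = "?J a"]) (use n_pos in \<open>auto simp del: drop_append\<close>)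
  let ?K = "\<lambda>a X w. ?I (a * n) X w"
  have "hoare (\<lambda>X w. ?K a X w \<and> row n X 18 a) (vfor 20 ?B) (2 + n * 7)
      (\<lambda>X w. ?K (Suc a) X w \<and> row n X 18 a)" if "a < n" for a
    by (rule hoare_conseq[OF 1[OF that]]) (auto simp: add.commute simp del: drop_append)
  then have "hoare (?K 0) (vfor 18 (vfor 20 ?B)) (2 + n * ((2 + n * 7) + 4)) (?K n)"
    by (intro hoare_vfor[where I = ?K]) (use n_pos in \<open>auto simp del: drop_append\<close>)
  then show ?thesis
  proof (rule hoare_conseq)
    fix X w assume *: "?K n X w"
    have "X (40 + a * n + b) = tv ({a, b} \<in> E)" if "a < n" "b < n" for a b
    proof -
      have "X (40 + (a * n + b)) = of_bool (?M ! (a * n + b))"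
        using * cell_less[OF that] by blast
      then show ?thesis by (simp add: nth_matrix[OF that] tv_def add.assoc)
    qed
    with * show "X 2 = n \<and> X 3 = Suc 0 \<and> X 28 = 40 + n * n \<and> w = w0 \<and>
      (\<forall>a<n. \<forall>b<n. X (40 + a * n + b) = tv ({a, b} \<in> E))"
      by (simp add: length_matrix)
  qed auto
qed

text \<open>The product of the digit read and the current power of 2 is looked up in registers
  25, 26, 27, which contain 0, that power, and 0 for the end of the input.\<close>

lemma hoare_read_budget:
  assumes "k > 0"
  shows "hoare (\<lambda>X w. X 2 = n \<and> X 3 = Suc 0 \<and> X 5 = 40 + n * n \<and>
      (\<forall>a<n. \<forall>b<n. X (40 + a * n + b) = tv ({a, b} \<in> E)) \<and>
      X 6 = 0 \<and> X 25 = 0 \<and> X 26 = 1 \<and> X 27 = 0 \<and> X 29 = 25 \<and> X 30 = 2 \<and>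
      w = map (bit k) [0..<floorlog 2 k])
    (repeat_while (block [Read 8, Add 9 8 29, Load 9 9, Add 6 6 9, Add 26 26 26, Sub 8 30 8]) 8)
    ((floorlog 2 k + 1) * 7) (\<lambda>X w. env X)"
proof -
  let ?l = "floorlog 2 k"
  let ?w = "map (bit k) [0..<?l]"
  have k: "k < 2 ^ ?l" using floorlog_bounds[of k 2] assms by simp
  let ?I = "\<lambda>j X w. X 2 = n \<and> X 3 = Suc 0 \<and> X 5 = 40 + n * n \<and>
    (\<forall>a<n. \<forall>b<n. X (40 + a * n + b) = tv ({a, b} \<in> E)) \<and>
    X 6 = take_bit j k \<and> X 25 = 0 \<and> X 26 = 2 ^ j \<and> X 27 = 0 \<and> X 29 = 25 \<and> X 30 = 2 \<and>
    w = drop j ?w"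
  let ?is = "[Read 8, Add 9 8 29, Load 9 9, Add 6 6 9, Add 26 26 26, Sub 8 30 8]"
  have "hoare (?I j) (block ?is) 6 (\<lambda>X w. ?I (Suc j) X w \<and> (X 8 > 0 \<longleftrightarrow> Suc j < ?l + 1))"
    if "j < ?l + 1" for j
  proof (rule hoare_conseq[OF hoare_block])
    fix X w assume *: "?I j X w"
    show "case fold eff ?is (X, w) of (X, w) \<Rightarrow> ?I (Suc j) X w \<and> (X 8 > 0 \<longleftrightarrow> Suc j < ?l + 1)"
    proof (cases "j < ?l")
      case True
      then have "eff (Read 8) (X, w) = (X(8 := of_bool (bit k j)), drop (Suc j) ?w)"
        using eff_Read_drop[of j ?w 8 X] * by simp
      with * True show ?thesis
        by (cases "bit k j") (simp_all add: take_bit_Suc_from_most del: drop_map)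
    next
      case False
      then have "j = ?l" using that by simp
      moreover from this have "w = []" using * by simp
      \<comment> \<open>The extra round that meets the end of the input adds 0, in accordance with
        the bit of \<open>k\<close> beyond its top digit.\<close>
      moreover have "\<not> bit k ?l" using k by (simp add: bit_iff_odd)
      ultimately show ?thesis using * by (simp add: take_bit_Suc_from_most del: drop_map)
    qed
  qed auto
  then have "hoare (?I 0) (repeat_while (block ?is) 8) ((?l + 1) * Suc 6) (?I (?l + 1))"
    by (rule hoare_repeat_while) auto
  note loop = this
  have "k < 2 ^ Suc ?l" using k by simp
  then have "take_bit (Suc ?l) k = k" by (simp only: take_bit_nat_eq_self)
  then show ?thesis
    by (intro hoare_conseq[OF loop]) (auto simp: env_def)
qed

lemma hoare_read_input:
  assumes "k > 0"
  shows "hoare (\<lambda>X w. w = mda_encode (n, E, k)) read_input (time_read n (floorlog 2 k)) (\<lambda>X w. env X)"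
proof -
  let ?K = "map (bit k) [0..<floorlog 2 k]"
  have 1: "hoare (\<lambda>X w. w = mda_encode (n, E, k)) (block [Const 2 0, Const 3 1]) 2
      (\<lambda>X w. X 2 = 0 \<and> X 3 = Suc 0 \<and> w = replicate n True @ False # matrix n E @ ?K)"
    by (rule hoare_conseq[OF hoare_block[where P = "\<lambda>X w. w = mda_encode (n, E, k)"]])
      (auto simp: matrix_def)
  have 2: "hoare (\<lambda>X w. X 2 = n \<and> X 3 = Suc 0 \<and> w = matrix n E @ ?K) (block [Const 28 40]) 1
      (\<lambda>X w. X 2 = n \<and> X 3 = Suc 0 \<and> X 28 = 40 \<and> w = matrix n E @ ?K)"
    by (rule hoare_conseq[OF hoare_block[where P = "\<lambda>X w. X 2 = n \<and> X 3 = Suc 0 \<and> w = matrix n E @ ?K"]])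
      auto
  let ?Q = "\<lambda>X w. X 2 = n \<and> X 3 = Suc 0 \<and> X 28 = 40 + n * n \<and> w = ?K \<and>
      (\<forall>a<n. \<forall>b<n. X (40 + a * n + b) = tv ({a, b} \<in> E))"
  have 3: "hoare ?Q
      (block [Const 29 0, Add 5 28 29, Const 6 0, Const 25 0, Const 26 1, Const 27 0, Const 29 25, Const 30 2]) 8
      (\<lambda>X w. X 2 = n \<and> X 3 = Suc 0 \<and> X 5 = 40 + n * n \<and>
        (\<forall>a<n. \<forall>b<n. X (40 + a * n + b) = tv ({a, b} \<in> E)) \<and>
        X 6 = 0 \<and> X 25 = 0 \<and> X 26 = 1 \<and> X 27 = 0 \<and> X 29 = 25 \<and> X 30 = 2 \<and> w = ?K)"
    by (rule hoare_conseq[OF hoare_block[where P = ?Q]]) auto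
  show ?thesis
    unfolding read_input_def time_read_def
    by (intro hoare_sequ[OF 1] hoare_sequ[OF hoare_read_unary] hoare_sequ[OF 2]
        hoare_sequ[OF hoare_read_matrix] hoare_sequ[OF 3] hoare_read_budget assms)
qed

end

section \<open>The running time\<close>

definition polynomial_fun :: "(nat \<Rightarrow> nat) \<Rightarrow> bool" where
  "polynomial_fun f \<longleftrightarrow> (\<exists>q. \<forall>n. f n = poly q n)"

lemma polynomial_fun_intros:
  "polynomial_fun (\<lambda>_. c)"
  "polynomial_fun (\<lambda>n. n)"
  "polynomial_fun f \<Longrightarrow> polynomial_fun g \<Longrightarrow> polynomial_fun (\<lambda>n. f n + g n)"
  "polynomial_fun f \<Longrightarrow> polynomial_fun g \<Longrightarrow> polynomial_fun (\<lambda>n. f n * g n)"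
proof -
  show "polynomial_fun (\<lambda>_. c)"
    unfolding polynomial_fun_def by (intro exI[of _ "[:c:]"]) simp
  show "polynomial_fun (\<lambda>n. n)"
    unfolding polynomial_fun_def by (intro exI[of _ "[:0, 1:]"]) simp
  show "polynomial_fun (\<lambda>n. f n + g n)" if "polynomial_fun f" "polynomial_fun g"
    using that unfolding polynomial_fun_def by (metis poly_add)
  show "polynomial_fun (\<lambda>n. f n * g n)" if "polynomial_fun f" "polynomial_fun g"
    using that unfolding polynomial_fun_def by (metis poly_mult)
qed

text \<open>With nothing around it, leaving the code means halting. All registers start at 0, so
  \<open>e\<close> only has to accommodate the constants in the code.\<close>

lemma hoare_runs:
  assumes "hoare P c t Q" "P (\<lambda>_. 0) w" "e \<ge> 1" "\<And>r d. Const r d \<in> set (c 0) \<Longrightarrow> d \<le> 2 ^ e"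
  shows "\<exists>s pc X w'. runs (c 0) (0, \<lambda>_. 0, w) s (pc, X, w') \<and> s \<le> t * (3 + 2 * (e + t)) \<and> Q X w'"
proof -
  obtain m X w' where m: "m \<le> t" "Q X w'" "(step1 (c 0) ^^ m) (0, \<lambda>_. 0, w) (0 + length (c 0), X, w')"
    using hoareD[OF assms(1,2), of "c 0" "[]" 0 "[]"] by auto
  obtain s where s: "s \<le> m * (3 + 2 * (e + m))" "runs (c 0) (0, \<lambda>_. 0, w) s (0 + length (c 0), X, w')"
    using runs_of_steps[OF m(3) _ _ assms(3)] assms(4) by auto
  have "m * (3 + 2 * (e + m)) \<le> t * (3 + 2 * (e + t))"
    using m(1) by (intro mult_le_mono add_le_mono) auto
  with s m(2) show ?thesis using le_trans by blast
qed

lemma mda_time_polynomial: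
  "polynomial_fun (\<lambda>l. time_read l l + time_search l)"
  unfolding time_read_def time_search_def time_uv_def time_x_def
  by (intro polynomial_fun_intros)

theorem theorem3p1:
  shows "poly_time_solvable mda_instances mda_encode (mda_question 3)"
proof -
  let ?c = "read_input ;; search"
  \<comment> \<open>Some bound on the constants exists because the program is finite; its value is
    irrelevant.\<close>
  have "finite {d. \<exists>r. Const r d \<in> set (?c 0)}"
  proof (rule finite_subset)
    show "{d. \<exists>r. Const r d \<in> set (?c 0)} \<subseteq> (\<lambda>i. case i of Const r d \<Rightarrow> d | _ \<Rightarrow> 0) ` set (?c 0)"
      by force
  qed simp
  then obtain e0 where "\<And>r d. Const r d \<in> set (?c 0) \<Longrightarrow> d \<le> e0"
    unfolding finite_nat_set_iff_bounded_le by blast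
  moreover have "e0 \<le> 2 ^ Suc e0" by (simp add: less_imp_le_nat[OF less_trans[OF less_exp]])
  ultimately have e: "\<And>r d. Const r d \<in> set (?c 0) \<Longrightarrow> d \<le> 2 ^ Suc e0" by (meson le_trans)
  let ?T = "\<lambda>l. time_read l l + time_search l"
  have "polynomial_fun (\<lambda>l. ?T l * (3 + 2 * (Suc e0 + ?T l)))"
    by (intro polynomial_fun_intros mda_time_polynomial)
  then obtain q where q: "\<And>l. ?T l * (3 + 2 * (Suc e0 + ?T l)) = poly q l"
    unfolding polynomial_fun_def by blast
  show ?thesis
    unfolding poly_time_solvable_def
  proof (intro exI[of _ "?c 0"] exI[of _ q] ballI)
    fix i assume "i \<in> mda_instances"
    then obtain n E k where i: "i = (n, E, k)" and G: "simple_graph {..<n} E"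
      "connected_graph {..<n} E" "k > 0"
      by (auto simp: mda_instances_def)
    have "n > 0" using G(2) by (auto simp: connected_graph_def)
    then interpret mda n E k using G(1) by unfold_locales
    let ?l = "length (mda_encode i)" and ?t = "time_read n (floorlog 2 k) + time_search n"
    \<comment> \<open>The unary prefix makes \<open>n\<close> at most the length of the
      input.\<close>
    have "n \<le> ?l" "floorlog 2 k \<le> ?l" by (auto simp: i)
    then have "time_read n (floorlog 2 k) \<le> time_read ?l ?l"
      unfolding time_read_def by (intro add_le_mono mult_le_mono) auto
    moreover have "time_search n \<le> time_search ?l"
      using \<open>n \<le> ?l\<close> unfolding time_search_def time_uv_def time_x_def
      by (intro add_le_mono mult_le_mono) auto
    ultimately have le: "?t \<le> ?T ?l" by simp
    have t: "?t * (3 + 2 * (Suc e0 + ?t)) \<le> poly q ?l"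
      unfolding q[symmetric]
      by (rule mult_le_mono[OF le]) (intro add_le_mono mult_le_mono le order_refl)
    obtain s pc X w where "runs (?c 0) (0, \<lambda>_. 0, mda_encode i) s (pc, X, w)"
      "s \<le> ?t * (3 + 2 * (Suc e0 + ?t))" "result UNIV X"
      using hoare_runs[OF hoare_sequ[OF hoare_read_input[OF G(3)] hoare_search], of "mda_encode i" "Suc e0"] e
      by (auto simp: i)
    then show "\<exists>t pc X w. runs (?c 0) (0, \<lambda>_. 0, mda_encode i) t (pc, X, w) \<and>
        t \<le> poly q (length (mda_encode i)) \<and> (X 0 \<noteq> 0 \<longleftrightarrow> mda_question 3 i)"
      using t result_correct[OF _ G(2)] le_trans unfolding i by blast
  qed
qed


end
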